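(* Let $k$ be a fixed positive integer. There exists a constant $n_0(k)$ such that the following holds. If $n\geq n_0(k)$, $t$ is an integer, and $S\subseteq \{0,1,2\}^n$ has cardinality at least \[\sum_{r=n-\left\lfloor \frac{k-1}{2}\right\rfloor}^{n+\left\lceil \frac{k-1}{2}\right\rceil}\ell_{r}(n)+ t,\] then \[\mathrm{comp}(S)\geq \left(\frac{\ell_{3k-1}(n)}{\ell_{2k-1}(n)} - 1\right)t.\]
   Context: $\{0,1,2\}^n$ is the poset in which $x\leq y$ if and only if $x_j\leq y_j$ for all $1\leq j\leq n$. For $0\leq i\leq 2n$, $\ell_i(n)$ denotes the number of vectors in $\{0,1,2\}^n$ whose coordinates sum to $i$. For a subset $S$ of a poset, $\mathrm{comp}(S)$ denotes the number of (unordered) pairs of distinct elements of $S$ that are comparable. *)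

theory Defs
  imports Complex_Main
begin

definition ternary_cube :: "nat \<Rightarrow> (nat \<Rightarrow> nat) set" where
  "ternary_cube n = {x. (\<forall>j<n. x j \<le> 2) \<and> (\<forall>j\<ge>n. x j = 0)}"

definition cube_le :: "nat \<Rightarrow> (nat \<Rightarrow> nat) \<Rightarrow> (nat \<Rightarrow> nat) \<Rightarrow> bool" where
  "cube_le n x y \<longleftrightarrow> (\<forall>j<n. x j \<le> y j)"

definition ell :: "nat \<Rightarrow> nat \<Rightarrow> nat" where
  "ell i n = card {x \<in> ternary_cube n. (\<Sum>j<n. x j) = i}"

definition comp :: "nat \<Rightarrow> (nat \<Rightarrow> nat) set \<Rightarrow> nat" where
  "comp n S = card {{x, y} | x y. x \<in> S \<and> y \<in> S \<and> x \<noteq> y \<and> cube_le n x y}"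

end

(* Choose a random maximal chain, as a Markov chain descending from the top, that is uniform on every
   layer. A chain meeting S in X points contains at least X - k pairs of S that are at least k layers
   apart, so on average such pairs make up for the excess of S over k layers. Write q(x) for the
   reciprocal of the size of the layer of x. It remains to see that the chain meets both elements of a
   distant pair with probability at most q(x) / rho, where x is the element further from the middle
   layer and rho is the constant of the theorem.

   Such a bound follows from a bound 2 / min(r, n) on every single step from rank r to rank r - 1,
   because at most m! descending paths join two elements m layers apart. The uniform chain is
   constructed explicitly: by symmetry a step depends only on the type (rank and number of 2s), and two
   consecutive layers form a path of types, which forces the flow.

   Elements of S comparable to at least rho others are removed one by one. For the remaining set,
   x gets the weight 1 - d(x) / rho in [0, 1], where d(x) counts the pairs charged to x, and a
   fractional knapsack argument shows that the total weight is at most the size of k middle layers. *)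

theory Submission
  imports Defs
begin

section \<open>Layers and types\<close>

text \<open>For large n the constant \<rho> is close to n^k / (2k (2k+1) ... (3k-1)), while for a
  pair exactly k layers apart, charged as described, the descending probability is at most about k!
  (2/n)^k. The product of the two is about the product of 2(l+1)/(2k+l) over l < k. It is smaller
  than 1 for k >= 2 but equal to 1 for k = 1, where the subtracted 1 in \<rho> saves the estimate.
  So the factor 2 in the bound for a single step has to be exact. That factor is forced by vectors
  without a coordinate 1: one of rank r has only r/2 steps down and n - r/2 steps up. The explicit
  flow is needed to show that no edge exceeds the formulas read off from these extreme vectors.
  Pairs more than k layers apart need less care: k + 1 steps of probability O(1/n) already beat
  \<rho>, provided that the inner element is not too far from the middle.\<close>

definition weight :: "nat \<Rightarrow> (nat \<Rightarrow> nat) \<Rightarrow> nat" where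
  "weight n x = (\<Sum>j<n. x j)"

definition layer :: "nat \<Rightarrow> nat \<Rightarrow> (nat \<Rightarrow> nat) set" where
  "layer n r = {x \<in> ternary_cube n. weight n x = r}"

definition mult_of :: "nat \<Rightarrow> nat \<Rightarrow> (nat \<Rightarrow> nat) \<Rightarrow> nat" where
  "mult_of c n x = (\<Sum>j<n. if x j = c then 1 else 0)"

definition twos_class :: "nat \<Rightarrow> nat \<Rightarrow> nat \<Rightarrow> (nat \<Rightarrow> nat) set" where
  "twos_class n r b = {x \<in> layer n r. mult_of 2 n x = b}"

definition twos_card :: "nat \<Rightarrow> nat \<Rightarrow> nat \<Rightarrow> nat" where
  "twos_card n r b = card (twos_class n r b)"

lemma ell_eq: "ell r n = card (layer n r)"
  by (simp add: ell_def layer_def weight_def)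

lemma finite_ternary_cube [simp]: "finite (ternary_cube n)"
proof -
  have "finite {f. \<forall>j. (j \<in> {..<n} \<longrightarrow> f j \<in> {..2}) \<and> (j \<notin> {..<n} \<longrightarrow> f j = (0::nat))}"
    by (rule finite_set_of_finite_funs) auto
  moreover have "ternary_cube n \<subseteq> {f. \<forall>j. (j \<in> {..<n} \<longrightarrow> f j \<in> {..2}) \<and> (j \<notin> {..<n} \<longrightarrow> f j = (0::nat))}"
    by (auto simp: ternary_cube_def)
  ultimately show ?thesis by (rule rev_finite_subset)
qed

lemma finite_layer [simp]: "finite (layer n r)"
  by (simp add: layer_def)

lemma finite_twos_class [simp]: "finite (twos_class n r b)"
  by (simp add: twos_class_def)

lemma cube_value: "x \<in> ternary_cube n \<Longrightarrow> x j = 0 \<or> x j = 1 \<or> x j = 2"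
proof -
  assume "x \<in> ternary_cube n"
  then have "x j \<le> 2" by (cases "j < n") (auto simp: ternary_cube_def)
  then show ?thesis by auto
qed

lemma cube_upd: "x \<in> ternary_cube n \<Longrightarrow> j < n \<Longrightarrow> v \<le> 2 \<Longrightarrow> x(j := v) \<in> ternary_cube n"
  by (auto simp: ternary_cube_def)

text \<open>Additive on both sides, so that no truncated subtraction of natural numbers
  occurs.\<close>

lemma sum_fun_upd:
  fixes f :: "nat \<Rightarrow> nat" and n j :: nat
  assumes "j < n"
  shows "(\<Sum>i<n. f ((x(j := v)) i)) + f (x j) = (\<Sum>i<n. f (x i)) + f v"
proof -
  have "(\<Sum>i\<in>{..<n} - {j}. f ((x(j := v)) i)) = (\<Sum>i\<in>{..<n} - {j}. f (x i))"
    by (rule sum.cong) auto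
  moreover have "sum g {..<n} = g j + sum g ({..<n} - {j})" for g :: "nat \<Rightarrow> nat"
    using assms by (intro sum.remove) auto
  ultimately show ?thesis by simp
qed

lemma weight_upd: "j < n \<Longrightarrow> weight n (x(j := v)) + x j = weight n x + v"
  unfolding weight_def by (rule sum_fun_upd[where f = "\<lambda>a. a"])

lemma mult_of_upd:
  "j < n \<Longrightarrow> mult_of c n (x(j := v)) + (if x j = c then 1 else 0)
     = mult_of c n x + (if v = c then 1 else 0)"
  unfolding mult_of_def by (rule sum_fun_upd[where f = "\<lambda>a. if a = c then 1 else 0"])

lemma mult_of_total:
  assumes "x \<in> ternary_cube n"
  shows "mult_of 0 n x + mult_of 1 n x + mult_of 2 n x = n"
proof -
  have "mult_of 0 n x + mult_of 1 n x + mult_of 2 n x = (\<Sum>j<n. 1)"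
    unfolding mult_of_def sum.distrib[symmetric]
  proof (rule sum.cong)
    fix j
    show "(if x j = 0 then 1 else 0) + (if x j = 1 then 1 else 0) + (if x j = 2 then 1 else 0) = (1::nat)"
      using cube_value[OF assms, of j] by auto
  qed simp
  then show ?thesis by simp
qed

lemma weight_mult_of:
  assumes "x \<in> ternary_cube n"
  shows "mult_of 1 n x + 2 * mult_of 2 n x = weight n x"
  unfolding mult_of_def weight_def sum_distrib_left sum.distrib[symmetric]
proof (rule sum.cong)
  fix j
  show "(if x j = 1 then 1 else 0) + 2 * (if x j = 2 then 1 else 0) = x j"
    using cube_value[OF assms, of j] by auto
qed simp

lemma weight_le: "x \<in> ternary_cube n \<Longrightarrow> weight n x \<le> 2 * n"
  using weight_mult_of[of x n] mult_of_total[of x n] by linarith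

lemma sum_mult_of:
  assumes "finite A"
  shows "(\<Sum>x\<in>A. mult_of c n x) = (\<Sum>j<n. card {x \<in> A. x j = c})"
proof -
  have "(\<Sum>x\<in>A. mult_of c n x) = (\<Sum>j<n. \<Sum>x\<in>A. if x j = c then 1 else 0)"
    unfolding mult_of_def by (rule sum.swap)
  also have "\<dots> = (\<Sum>j<n. card {x \<in> A. x j = c})"
    using assms by (simp add: sum.If_cases Int_def)
  finally show ?thesis .
qed

section \<open>Double counting of covering pairs between types\<close>

lemma card_lower:
  assumes "j < n" "v \<le> 1"
    and AB: "\<And>x. x j = Suc v \<Longrightarrow> x \<in> A \<Longrightarrow> x(j := v) \<in> B"
    and BA: "\<And>y. y j = v \<Longrightarrow> y \<in> B \<Longrightarrow> y(j := Suc v) \<in> A"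
  shows "card {x \<in> A. x j = Suc v} = card {y \<in> B. y j = v}"
proof (rule bij_betw_same_card)
  show "bij_betw (\<lambda>x. x(j := v)) {x \<in> A. x j = Suc v} {y \<in> B. y j = v}"
    by (rule bij_betw_byWitness[where f' = "\<lambda>y. y(j := Suc v)"])
      (use AB BA in \<open>auto simp: fun_upd_idem\<close>)
qed

text \<open>Both sides count the covering pairs that turn a 1 into a 0, coordinate by coordinate:
  lowering the coordinate is a bijection and keeps the number of 2s.\<close>

lemma double_count_10:
  "(\<Sum>x\<in>twos_class n (Suc s) b. mult_of 1 n x) = (\<Sum>y\<in>twos_class n s b. mult_of 0 n y)"
  unfolding sum_mult_of[OF finite_twos_class]
proof (rule sum.cong)
  fix j assume "j \<in> {..<n}"
  then have j: "j < n" by simp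
  have "card {x \<in> twos_class n (Suc s) b. x j = Suc 0} = card {y \<in> twos_class n s b. y j = 0}"
    using j
  proof (rule card_lower)
    fix x assume "x j = Suc 0" "x \<in> twos_class n (Suc s) b"
    then show "x(j := 0) \<in> twos_class n s b"
      using j weight_upd[OF j, of x 0] mult_of_upd[OF j, of 2 x 0]
      by (auto simp: twos_class_def layer_def cube_upd)
  next
    fix y assume "y j = 0" "y \<in> twos_class n s b"
    then show "y(j := Suc 0) \<in> twos_class n (Suc s) b"
      using j weight_upd[OF j, of y 1] mult_of_upd[OF j, of 2 y 1]
      by (auto simp: twos_class_def layer_def cube_upd)
  qed simp
  then show "card {x \<in> twos_class n (Suc s) b. x j = 1} = card {y \<in> twos_class n s b. y j = 0}"
    by simp
qed simp

lemma double_count_21: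
  "(\<Sum>x\<in>twos_class n (Suc s) (Suc b). mult_of 2 n x) = (\<Sum>y\<in>twos_class n s b. mult_of 1 n y)"
  unfolding sum_mult_of[OF finite_twos_class]
proof (rule sum.cong)
  fix j assume "j \<in> {..<n}"
  then have j: "j < n" by simp
  have "card {x \<in> twos_class n (Suc s) (Suc b). x j = Suc 1} = card {y \<in> twos_class n s b. y j = 1}"
    using j
  proof (rule card_lower)
    fix x assume "x j = Suc 1" "x \<in> twos_class n (Suc s) (Suc b)"
    then show "x(j := 1) \<in> twos_class n s b"
      using j weight_upd[OF j, of x 1] mult_of_upd[OF j, of 2 x 1]
      by (auto simp: twos_class_def layer_def cube_upd)
  next
    fix y assume "y j = 1" "y \<in> twos_class n s b"
    then show "y(j := Suc 1) \<in> twos_class n (Suc s) (Suc b)"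
      using j weight_upd[OF j, of y 2] mult_of_upd[OF j, of 2 y 2]
      by (auto simp: twos_class_def layer_def cube_upd numeral_2_eq_2)
  qed simp
  then show "card {x \<in> twos_class n (Suc s) (Suc b). x j = 2} = card {y \<in> twos_class n s b. y j = 1}"
    by (simp add: numeral_2_eq_2)
qed simp

lemma twos_class_mult_of:
  assumes "x \<in> twos_class n r b"
  shows "mult_of 2 n x = b" "real (mult_of 1 n x) = real r - 2 * real b"
    "real (mult_of 0 n x) = real n - real r + real b"
proof -
  have x: "x \<in> ternary_cube n" "weight n x = r" and b: "mult_of 2 n x = b"
    using assms by (auto simp: twos_class_def layer_def)
  show "mult_of 2 n x = b" by (fact b)
  show "real (mult_of 1 n x) = real r - 2 * real b"
    using weight_mult_of[OF x(1)] x b by simp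
  show "real (mult_of 0 n x) = real n - real r + real b"
    using weight_mult_of[OF x(1)] mult_of_total[OF x(1)] x b by linarith
qed

lemma twos_card_zero: "r < 2 * b \<Longrightarrow> twos_card n r b = 0"
  using twos_class_mult_of(2)[of _ n r b] by (force simp: twos_card_def)

lemma twos_card_ones:
  "(real s + 1 - 2 * real b) * twos_card n (Suc s) b = (real n - real s + real b) * twos_card n s b"
proof -
  have "real (\<Sum>x\<in>twos_class n (Suc s) b. mult_of 1 n x)
      = (real s + 1 - 2 * real b) * twos_card n (Suc s) b"
    using twos_class_mult_of(2)[of _ n "Suc s" b] by (simp add: twos_card_def)
  moreover have "real (\<Sum>y\<in>twos_class n s b. mult_of 0 n y) = (real n - real s + real b) * twos_card n s b"
    using twos_class_mult_of(3)[of _ n s b] by (simp add: twos_card_def)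
  ultimately show ?thesis using double_count_10[of n s b] by metis
qed

lemma twos_card_twos:
  "(real b + 1) * twos_card n (Suc s) (Suc b) = (real s - 2 * real b) * twos_card n s b"
proof -
  have "real (\<Sum>x\<in>twos_class n (Suc s) (Suc b). mult_of 2 n x)
      = (real b + 1) * twos_card n (Suc s) (Suc b)"
    using twos_class_mult_of(1)[of _ n "Suc s" "Suc b"] by (simp add: twos_card_def algebra_simps)
  moreover have "real (\<Sum>y\<in>twos_class n s b. mult_of 1 n y) = (real s - 2 * real b) * twos_card n s b"
    using twos_class_mult_of(2)[of _ n s b] by (simp add: twos_card_def)
  ultimately show ?thesis using double_count_21[of n s b] by metis
qed

text \<open>The bound \<open>m\<close> stays free so that two adjacent layers can be split over one
  common index range.\<close>

lemma layer_eq_UN: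
  assumes "r < 2 * m" shows "layer n r = (\<Union>b<m. twos_class n r b)"
proof -
  have "mult_of 2 n x < m" if "x \<in> layer n r" for x
    using weight_mult_of[of x n] that assms by (auto simp: layer_def)
  then show ?thesis by (auto simp: twos_class_def)
qed

lemma sum_layer:
  assumes "r < 2 * m" shows "(\<Sum>x\<in>layer n r. f x) = (\<Sum>b<m. \<Sum>x\<in>twos_class n r b. f x)"
  unfolding layer_eq_UN[OF assms]
  by (rule sum.UNION_disjoint) (auto simp: twos_class_def)

lemma sum_twos_card: "r < 2 * m \<Longrightarrow> (\<Sum>b<m. twos_card n r b) = ell r n"
  using sum_layer[of r m "\<lambda>_. 1::nat" n] by (simp add: ell_eq twos_card_def)

section \<open>Layer sizes\<close>

definition complement :: "nat \<Rightarrow> (nat \<Rightarrow> nat) \<Rightarrow> nat \<Rightarrow> nat" where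
  "complement n x = (\<lambda>j. if j < n then 2 - x j else 0)"

lemma complement_cube [simp]: "complement n x \<in> ternary_cube n"
  by (simp add: complement_def ternary_cube_def)

lemma complement_complement [simp]:
  "x \<in> ternary_cube n \<Longrightarrow> complement n (complement n x) = x"
  by (auto simp: complement_def ternary_cube_def)

lemma weight_complement: "x \<in> ternary_cube n \<Longrightarrow> weight n (complement n x) + weight n x = 2 * n"
proof -
  assume x: "x \<in> ternary_cube n"
  have "weight n (complement n x) + weight n x = (\<Sum>j<n. 2)"
    unfolding weight_def sum.distrib[symmetric]
    by (rule sum.cong) (use x in \<open>auto simp: complement_def ternary_cube_def\<close>)
  then show ?thesis by simp
qed

lemma bij_complement: "bij_betw (complement n) (ternary_cube n) (ternary_cube n)"
  by (rule bij_betw_byWitness[where f' = "complement n"]) auto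

lemma ell_symmetric: "i \<le> 2 * n \<Longrightarrow> ell (2 * n - i) n = ell i n"
proof -
  assume i: "i \<le> 2 * n"
  have "bij_betw (complement n) (layer n (2 * n - i)) (layer n i)"
  proof (rule bij_betw_byWitness[where f' = "complement n"])
    show "complement n ` layer n (2 * n - i) \<subseteq> layer n i"
      using i weight_complement by (fastforce simp: layer_def)
    show "complement n ` layer n i \<subseteq> layer n (2 * n - i)"
      using i weight_complement by (fastforce simp: layer_def)
  qed (auto simp: layer_def)
  then show ?thesis unfolding ell_eq by (rule bij_betw_same_card)
qed

lemma ell_zero: "2 * n < i \<Longrightarrow> ell i n = 0"
  using weight_le by (fastforce simp: ell_eq layer_def)

text \<open>Vectors vanish outside their index range, so setting coordinate \<open>n\<close> to 0
  deletes it.\<close>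

lemma card_layer_last:
  assumes "v \<le> 2" "v \<le> r"
  shows "card {x \<in> layer (Suc n) r. x n = v} = ell (r - v) n"
  unfolding ell_eq
proof (rule bij_betw_same_card)
  have up: "x(n := 0) \<in> ternary_cube n" if "x \<in> ternary_cube (Suc n)" for x
    using that by (auto simp: ternary_cube_def)
  have dn: "x(n := v) \<in> ternary_cube (Suc n)" "x n = 0" if "x \<in> ternary_cube n" for x
    using that assms by (auto simp: ternary_cube_def)
  have w: "weight n (x(n := u)) = weight n x" for x u
    by (simp add: weight_def)
  show "bij_betw (\<lambda>x. x(n := 0)) {x \<in> layer (Suc n) r. x n = v} (layer n (r - v))"
  proof (rule bij_betw_byWitness[where f' = "\<lambda>x. x(n := v)"])
    show "(\<lambda>x. x(n := 0)) ` {x \<in> layer (Suc n) r. x n = v} \<subseteq> layer n (r - v)"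
      using up w by (auto simp: layer_def) (simp add: weight_def)
    show "(\<lambda>x. x(n := v)) ` layer n (r - v) \<subseteq> {x \<in> layer (Suc n) r. x n = v}"
      using dn w assms by (auto simp: layer_def) (auto simp: weight_def)
  qed (auto simp: layer_def fun_upd_idem dn)
qed

lemma ell_Suc:
  "ell i (Suc n) = ell i n + (if 1 \<le> i then ell (i - 1) n else 0) + (if 2 \<le> i then ell (i - 2) n else 0)"
proof -
  let ?A = "\<lambda>v. {x \<in> layer (Suc n) i. x n = v}"
  have z: "?A v = {}" if "\<not> v \<le> i" for v
    using that by (auto simp: layer_def weight_def)
  have "layer (Suc n) i = ?A 0 \<union> ?A 1 \<union> ?A 2"
    using cube_value by (fastforce simp: layer_def)
  then have "ell i (Suc n) = card (?A 0 \<union> ?A 1 \<union> ?A 2)"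
    by (simp add: ell_eq)
  also have "\<dots> = card (?A 0) + card (?A 1) + card (?A 2)"
    by (subst card_Un_disjoint; (subst card_Un_disjoint)?) auto
  finally show ?thesis
    using z[of 1] z[of 2] card_layer_last[of 0 i n] card_layer_last[of 1 i n] card_layer_last[of 2 i n]
    by auto
qed

text \<open>By the three-term recurrence, the increment from i to i + 1 in dimension n + 1 is
  \<open>ell (i + 1) n - ell (i - 2) n\<close>. For i = n the index i + 1 has passed the middle of
  dimension n and is reflected to n - 1.\<close>

lemma ell_mono_Suc: "Suc i \<le> n \<Longrightarrow> ell i n \<le> ell (Suc i) n"
proof (induction n arbitrary: i)
  case (Suc n)
  have mono: "ell i n \<le> ell j n" if "i \<le> j" "j \<le> n" for i j
    using that by (induction j rule: dec_induct) (auto intro: le_trans Suc.IH)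
  have "(if 2 \<le> i then ell (i - 2) n else 0) \<le> ell (Suc i) n"
  proof (cases "Suc i \<le> n")
    case True
    then show ?thesis using mono[of "i - 2" "Suc i"] by auto
  next
    case False
    then have i: "i = n" using Suc.prems by simp
    show ?thesis
    proof (cases "2 \<le> n")
      case True
      then have "2 * n - (n - 1) = Suc n" by simp
      then have "ell (Suc n) n = ell (n - 1) n"
        using ell_symmetric[of "n - 1" n] True by simp
      then show ?thesis using i mono[of "n - 2" "n - 1"] by auto
    qed (use i in auto)
  qed
  moreover have "ell (Suc i) (Suc n) = ell (Suc i) n + ell i n + (if 1 \<le> i then ell (i - 1) n else 0)"
    by (simp add: ell_Suc[of "Suc i" n] numeral_2_eq_2)
  ultimately show ?case unfolding ell_Suc[of i n] by linarith
qed simp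

lemma ell_mono: "i \<le> j \<Longrightarrow> j \<le> n \<Longrightarrow> ell i n \<le> ell j n"
  by (induction j rule: dec_induct) (auto intro: le_trans ell_mono_Suc)

text \<open>Meant for \<open>d = k div 2\<close>, where layer \<open>n + d\<close> is the smallest
  of the k middle layers.\<close>

lemma ell_le_central:
  assumes "d \<le> n" "i + d \<le> n \<or> n + d \<le> i"
  shows "ell i n \<le> ell (n + d) n"
proof -
  have s: "ell (n + d) n = ell (n - d) n"
    using ell_symmetric[of "n - d" n] assms(1) by (simp add: add.commute)
  consider "i + d \<le> n" | "n + d \<le> i" "i \<le> 2 * n" | "2 * n < i"
    using assms(2) by linarith
  then show ?thesis
  proof cases
    case 1
    then show ?thesis unfolding s by (intro ell_mono) auto
  next
    case 2
    then have "ell i n = ell (2 * n - i) n" using ell_symmetric[of i n] by simp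
    also have "\<dots> \<le> ell (n - d) n" using 2 by (intro ell_mono) auto
    finally show ?thesis unfolding s .
  qed (simp add: ell_zero)
qed

lemma ell_ge_central:
  assumes "d \<le> n" "n \<le> i + d" "i \<le> n + d"
  shows "ell (n + d) n \<le> ell i n"
proof (cases "i \<le> n")
  case True
  have "ell (n + d) n = ell (n - d) n"
    using ell_symmetric[of "n - d" n] assms(1) by (simp add: add.commute)
  also have "\<dots> \<le> ell i n" using assms True by (intro ell_mono) auto
  finally show ?thesis .
next
  case False
  have "ell (n + d) n = ell (n - d) n"
    using ell_symmetric[of "n - d" n] assms(1) by (simp add: add.commute)
  also have "\<dots> \<le> ell (2 * n - i) n" using assms False by (intro ell_mono) auto
  finally show ?thesis using ell_symmetric[of i n] assms by simp
qed

section \<open>Ratios of consecutive layer sizes from the numbers of 0s, 1s and 2s\<close>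

definition zeros_in_layer :: "nat \<Rightarrow> nat \<Rightarrow> nat" where
  "zeros_in_layer n i = (\<Sum>x\<in>layer n i. mult_of 0 n x)"

lemma ones_in_layer_Suc: "(\<Sum>x\<in>layer n (Suc i). mult_of 1 n x) = zeros_in_layer n i"
proof -
  have "Suc i < 2 * (i + 2)" "i < 2 * (i + 2)" by simp_all
  then show ?thesis
    unfolding zeros_in_layer_def by (simp only: sum_layer double_count_10)
qed

lemma twos_in_layer_Suc: "(\<Sum>x\<in>layer n (Suc i). mult_of 2 n x) = (\<Sum>x\<in>layer n i. mult_of 1 n x)"
proof -
  have "(\<Sum>x\<in>layer n (Suc i). mult_of 2 n x)
      = (\<Sum>b<Suc (i + 2). \<Sum>x\<in>twos_class n (Suc i) b. mult_of 2 n x)"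
    by (rule sum_layer) simp
  also have "\<dots> = (\<Sum>b<i + 2. \<Sum>x\<in>twos_class n i b. mult_of 1 n x)"
    \<comment> \<open>The summand for b = 0 vanishes because its vectors have no 2; the others are
      shifted by one.\<close>
    unfolding sum.lessThan_Suc_shift double_count_21
    by (simp add: twos_class_mult_of(1))
  also have "\<dots> = (\<Sum>x\<in>layer n i. mult_of 1 n x)"
    by (rule sum_layer[symmetric]) simp
  finally show ?thesis .
qed

lemma ones_in_layer_0: "(\<Sum>x\<in>layer n 0. mult_of 1 n x) = 0"
proof -
  have "mult_of 1 n x = 0" if "x \<in> layer n 0" for x
    using weight_mult_of[of x n] that by (auto simp: layer_def)
  then show ?thesis by simp
qed

lemma twos_in_layer_0: "(\<Sum>x\<in>layer n 0. mult_of 2 n x) = 0"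
proof -
  have "mult_of 2 n x = 0" if "x \<in> layer n 0" for x
    using weight_mult_of[of x n] that by (auto simp: layer_def)
  then show ?thesis by simp
qed

lemma ones_in_layer: "(\<Sum>x\<in>layer n i. mult_of 1 n x) = (if 1 \<le> i then zeros_in_layer n (i - 1) else 0)"
  using ones_in_layer_Suc[of n "i - 1"] ones_in_layer_0[of n] by (cases i) auto

lemma twos_in_layer: "(\<Sum>x\<in>layer n i. mult_of 2 n x) = (if 2 \<le> i then zeros_in_layer n (i - 2) else 0)"
proof (cases i)
  case (Suc j)
  then show ?thesis
    using twos_in_layer_Suc[of n j] ones_in_layer[of n j] by (simp add: numeral_2_eq_2)
qed (simp add: twos_in_layer_0)

lemma sum_layer_const: "(\<Sum>x\<in>layer n i. f x) = c * ell i n" if "\<And>x. x \<in> layer n i \<Longrightarrow> f x = c"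
  for c :: nat
  using that by (simp add: ell_eq)

lemma layer_total:
  "n * ell i n = zeros_in_layer n i + (\<Sum>x\<in>layer n i. mult_of 1 n x) + (\<Sum>x\<in>layer n i. mult_of 2 n x)"
  unfolding zeros_in_layer_def sum.distrib[symmetric]
  by (rule sum_layer_const[symmetric]) (auto simp: layer_def dest: mult_of_total)

lemma layer_weight:
  "i * ell i n = (\<Sum>x\<in>layer n i. mult_of 1 n x) + 2 * (\<Sum>x\<in>layer n i. mult_of 2 n x)"
  unfolding sum_distrib_left sum.distrib[symmetric]
  by (rule sum_layer_const[symmetric]) (auto simp: layer_def dest: weight_mult_of)

text \<open>Deleting a zero coordinate suggests the formula. Both sides satisfy the same recurrence
  in i, since layer i has as many 1s as layer i - 1 has 0s, and as many 2s as layer i - 2 has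
  0s.\<close>

lemma zeros_in_layer_eq: "zeros_in_layer (Suc p) i = Suc p * ell i p"
proof (induction i rule: less_induct)
  case (less i)
  have a: "Suc p * ell i (Suc p) = Suc p * ell i p
      + (if 1 \<le> i then Suc p * ell (i - 1) p else 0) + (if 2 \<le> i then Suc p * ell (i - 2) p else 0)"
    unfolding ell_Suc[of i p] by (auto simp add: distrib_left simp del: mult_Suc)
  have b: "Suc p * ell i (Suc p) = zeros_in_layer (Suc p) i
      + (if 1 \<le> i then Suc p * ell (i - 1) p else 0) + (if 2 \<le> i then Suc p * ell (i - 2) p else 0)"
    using layer_total[of "Suc p" i] unfolding ones_in_layer twos_in_layer
    using less[of "i - 1"] less[of "i - 2"] by (auto split: if_splits)
  show ?case using a b by linarith
qed

lemma zeros_in_layer_mono: "i \<le> j \<Longrightarrow> j < n \<Longrightarrow> zeros_in_layer n i \<le> zeros_in_layer n j"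
  by (cases n) (auto simp: zeros_in_layer_eq intro!: mult_le_mono2 ell_mono simp del: mult_Suc)

lemma ell_Suc_weight:
  "Suc i * ell (Suc i) n = zeros_in_layer n i + 2 * (\<Sum>x\<in>layer n i. mult_of 1 n x)"
  using layer_weight[of "Suc i" n] ones_in_layer_Suc[of n i] twos_in_layer_Suc[of n i] by simp

text \<open>If Z(i) is the number of 0s in layer i, the two sides are Z(i) + Z(i-1) + Z(i-2) and
  Z(i) + 2 Z(i-1), and Z increases below n.\<close>

lemma ell_ratio_lower_half:
  assumes "i \<le> n" shows "n * ell i n \<le> Suc i * ell (Suc i) n"
proof -
  have "(if 2 \<le> i then zeros_in_layer n (i - 2) else 0) \<le> (if 1 \<le> i then zeros_in_layer n (i - 1) else 0)"
    using assms by (auto intro: zeros_in_layer_mono)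
  then show ?thesis
    unfolding ell_Suc_weight layer_total[of n i] ones_in_layer twos_in_layer by linarith
qed

text \<open>With Z as before, the claim reads Z(i) + 2 Z(i-1) <= 2 Z(i) + Z(i-1).\<close>

lemma ell_ratio_upper_half:
  assumes "i < n" shows "Suc i * ell (Suc i) n \<le> (2 * n - i) * ell i n"
proof -
  have "(2 * n - i) * ell i n = 2 * (n * ell i n) - i * ell i n"
    by (simp add: diff_mult_distrib)
  also have "\<dots> = 2 * zeros_in_layer n i + (\<Sum>x\<in>layer n i. mult_of 1 n x)"
    unfolding layer_total[of n i] layer_weight[of i n] by simp
  finally have e: "(2 * n - i) * ell i n = \<dots>" .
  have "(if 1 \<le> i then zeros_in_layer n (i - 1) else 0) \<le> zeros_in_layer n i"
    using assms by (auto intro: zeros_in_layer_mono)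
  then show ?thesis
    unfolding e ell_Suc_weight ones_in_layer by linarith
qed

lemma ell_Suc_le: "Suc i * ell (Suc i) n \<le> (n + i) * ell i n"
proof -
  have "(\<Sum>x\<in>layer n i. mult_of 1 n x) \<le> i * ell i n"
    using layer_weight[of i n] by linarith
  then show ?thesis
    unfolding ell_Suc_weight distrib_right layer_total[of n i] by linarith
qed

lemma ell_ratio_upper:
  assumes "s < 2 * n" shows "min (Suc s) n * ell (Suc s) n \<le> (2 * n - s) * ell s n"
proof (cases "s < n")
  case True
  then show ?thesis using ell_ratio_upper_half[of s n] by (simp add: min_def)
next
  case False
  have "Suc (2 * n - Suc s) = 2 * n - s" using assms by simp
  then show ?thesis
    using ell_ratio_lower_half[of "2 * n - Suc s" n] ell_symmetric[of s n] ell_symmetric[of "Suc s" n] assms False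
    by (simp add: min_def)
qed

lemma ell_ratio_lower:
  assumes "s < 2 * n" shows "min (2 * n - s) n * ell s n \<le> Suc s * ell (Suc s) n"
proof -
  have "Suc (2 * n - Suc s) = 2 * n - s" "2 * n - (2 * n - Suc s) = Suc s" using assms by simp_all
  then show ?thesis
    using ell_ratio_upper[of "2 * n - Suc s" n] ell_symmetric[of s n] ell_symmetric[of "Suc s" n] assms
    by simp
qed

lemma ell_0: "ell 0 n = 1"
proof (induction n)
  case 0
  have "{x :: nat \<Rightarrow> nat. \<forall>j. x j = 0} = {\<lambda>_. 0}" by auto
  then show ?case by (simp add: ell_def ternary_cube_def)
qed (simp add: ell_Suc)

lemma ell_pos: "i \<le> 2 * n \<Longrightarrow> 0 < ell i n"
proof -
  assume i: "i \<le> 2 * n"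
  have pos: "0 < ell j n" if "j \<le> n" for j
    using ell_mono[of 0 j n] ell_0[of n] that by simp
  show ?thesis
    using pos[of i] pos[of "2 * n - i"] ell_symmetric[OF i] by (cases "i \<le> n") auto
qed

section \<open>The uniform flow between adjacent layers\<close>

text \<open>Partial sums grow up to the first negative entry. From there on they only decrease, and
  they end at a nonnegative total.\<close>

lemma partial_sum_nonneg:
  fixes D :: "nat \<Rightarrow> real"
  assumes total: "0 \<le> (\<Sum>c<m. D c)"
    and cross: "\<And>c c'. D c < 0 \<Longrightarrow> c < c' \<Longrightarrow> c' < m \<Longrightarrow> D c' \<le> 0"
    and "b \<le> m"
  shows "0 \<le> (\<Sum>c<b. D c)"
proof (cases "\<exists>c<b. D c < 0")
  case True
  then obtain c where c: "c < b" "D c < 0" by blast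
  have "(\<Sum>c<m. D c) = (\<Sum>c<b. D c) + (\<Sum>c=b..<m. D c)"
    using sum.atLeastLessThan_concat[of 0 b m D] \<open>b \<le> m\<close> by (simp add: atLeast0LessThan)
  moreover have "(\<Sum>c=b..<m. D c) \<le> 0"
    using c cross by (intro sum_nonpos) auto
  ultimately show ?thesis using total by linarith
next
  case False
  then show ?thesis by (intro sum_nonneg) (metis lessThan_iff not_less)
qed

text \<open>A convex function lies below its chord between \<open>c\<close> and \<open>R\<close>;
  the identity in the proof is the chord with its exact error term.\<close>

lemma convex_quadratic_nonpos:
  fixes A B C c c' R :: real
  assumes "0 \<le> A" "c < c'" "c' \<le> R"
    and c: "A * c\<^sup>2 + B * c + C \<le> 0" and R: "A * R\<^sup>2 + B * R + C \<le> 0"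
  shows "A * c'\<^sup>2 + B * c' + C \<le> 0"
proof -
  have "(R - c) * (A * c'\<^sup>2 + B * c' + C)
      = (R - c') * (A * c\<^sup>2 + B * c + C) + (c' - c) * (A * R\<^sup>2 + B * R + C)
        - A * ((R - c') * (c' - c) * (R - c))"
    by (simp add: algebra_simps power2_eq_square)
  also have "\<dots> \<le> 0"
  proof -
    have "(R - c') * (A * c\<^sup>2 + B * c + C) \<le> 0" "(c' - c) * (A * R\<^sup>2 + B * R + C) \<le> 0"
      using assms by (simp_all add: mult_nonneg_nonpos)
    moreover have "0 \<le> A * ((R - c') * (c' - c) * (R - c))"
      using assms by (intro mult_nonneg_nonneg) auto
    ultimately show ?thesis by linarith
  qed
  finally show ?thesis using assms by (simp add: mult_le_0_iff)
qed

text \<open>Here \<open>f b\<close> and \<open>g b\<close> are the numbers of vectors with \<open>b\<close> coordinates equal to 2 of rank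
  \<open>s + 1\<close> and \<open>s\<close>, and \<open>lam\<close> is the ratio of the two layer sizes. The equations \<open>ones\<close> and \<open>twos\<close>
  count the covering pairs that change a 1 to 0 and a 2 to 1.\<close>

locale adjacent_layers =
  fixes n s m :: nat and f g :: "nat \<Rightarrow> real" and lam :: real
  assumes s_less: "s < 2 * n" and m_large: "s + 3 < 2 * m"
    and f_nonneg: "0 \<le> f b" and g_nonneg: "0 \<le> g b"
    and f_zero: "s + 1 < 2 * b \<Longrightarrow> f b = 0" and g_zero: "s < 2 * b \<Longrightarrow> g b = 0"
    and ones: "(real s + 1 - 2 * real b) * f b = (real n - real s + real b) * g b"
    and twos: "(real b + 1) * f (Suc b) = (real s - 2 * real b) * g b"
    and lam_pos: "0 < lam"
    and total: "(\<Sum>b<m. f b) = lam * (\<Sum>b<m. g b)"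
    and lam_le: "lam \<le> 2 * (2 * real n - real s) / (real s + 1)"
begin

definition g' :: "nat \<Rightarrow> real" where "g' c = (if c = 0 then 0 else g (c - 1))"

text \<open>With mass 1 on each vector of rank \<open>s + 1\<close> and \<open>lam\<close> on each of rank \<open>s\<close>, these are the masses
  that leave the upper type \<open>b\<close> along all its edges changing a 1 (to the lower type \<open>b\<close>), respectively
  a 2 (to the lower type \<open>b - 1\<close>).\<close>

definition flow_one :: "nat \<Rightarrow> real" where
  "flow_one b = (\<Sum>c<Suc b. f c) - lam * (\<Sum>c<b. g c)"

definition flow_two :: "nat \<Rightarrow> real" where
  "flow_two b = lam * (\<Sum>c<b. g c) - (\<Sum>c<b. f c)"

lemma sum_g': "(\<Sum>c<Suc b. g' c) = (\<Sum>c<b. g c)"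
  by (induction b) (simp_all add: g'_def)

lemma g'_nonneg: "0 \<le> g' c"
  by (simp add: g'_def g_nonneg)

lemma twos': "(real s + 2 - 2 * real c) * g' c = real c * f c"
  using twos[of "c - 1"] by (cases c) (auto simp: g'_def algebra_simps)

lemma ones': "(real s + 3 - 2 * real c) * (if c = 0 then 0 else f (c - 1)) = (real n - real s + real c - 1) * g' c"
  using ones[of "c - 1"] by (cases c) (auto simp: g'_def algebra_simps)

lemma g'_zero: "s + 2 < 2 * c \<Longrightarrow> g' c = 0"
  by (auto simp: g'_def g_zero)

text \<open>n - s + c is the number of 0s in a vector of rank s with c coordinates equal to 2, so a
  negative value means an empty type.\<close>

lemma g_zero_of_full: "real n - real s + real c < 0 \<Longrightarrow> g c = 0"
proof (rule ccontr)
  assume a: "real n - real s + real c < 0" and "g c \<noteq> 0"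
  then have "0 < g c" using g_nonneg[of c] by simp
  then have "2 * c \<le> s" using g_zero[of c] by (cases "s < 2 * c") auto
  then have "0 \<le> (real s + 1 - 2 * real c) * f c"
    using f_nonneg by (intro mult_nonneg_nonneg) auto
  then show False
    using a \<open>0 < g c\<close> unfolding ones by (simp add: zero_le_mult_iff)
qed

lemma positive_zeros:
  assumes "0 < f c" "2 * c < s + 1"
  shows "0 < real n - real s + real c"
proof -
  have "0 < (real s + 1 - 2 * real c) * f c"
    using assms by (intro mult_pos_pos) auto
  then show ?thesis
    unfolding ones using g_nonneg[of c] by (simp add: zero_less_mult_iff)
qed

text \<open>The flow is a partial sum of \<open>f c - lam * g' c\<close>. By \<open>twos'\<close>,
  in the range where s + 2 - 2c is positive, a negative entry forces s + 2 - 2c - lam c to be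
  negative, and this expression decreases in c.\<close>

lemma flow_one_nonneg:
  assumes "b < m" shows "0 \<le> flow_one b"
proof -
  define u where "u c = f c - lam * g' c" for c
  have u: "(real s + 2 - 2 * real c) * u c = f c * (real s + 2 - 2 * real c - lam * real c)" for c
    using arg_cong[OF twos'[of c], of "\<lambda>t. lam * t"] by (simp add: u_def algebra_simps)
  have "0 \<le> (\<Sum>c<Suc b. u c)"
  proof (rule partial_sum_nonneg)
    obtain m' where m': "m = Suc m'" using assms by (cases m) auto
    have "(\<Sum>c<m. u c) = (\<Sum>c<m. f c) - lam * (\<Sum>c<m'. g c)"
      unfolding u_def sum_subtractf sum_distrib_left[symmetric] m' sum_g' ..
    also have "\<dots> = lam * g m'" using total unfolding m' by (simp add: algebra_simps)
    finally show "0 \<le> (\<Sum>c<m. u c)" using lam_pos g_nonneg[of m'] by simp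
  next
    fix c c' assume c: "u c < 0" "c < c'" "c' < m"
    show "u c' \<le> 0"
    proof (cases "s + 2 \<le> 2 * c'")
      case True
      then show ?thesis using f_zero[of c'] lam_pos g'_nonneg[of c'] by (simp add: u_def)
    next
      case False
      then have p: "0 < real s + 2 - 2 * real c'" "0 < real s + 2 - 2 * real c" using c(2) by auto
      have "f c * (real s + 2 - 2 * real c - lam * real c) < 0"
        unfolding u[symmetric] using p(2) c(1) by (simp add: mult_pos_neg)
      then have "real s + 2 - 2 * real c - lam * real c < 0"
        using f_nonneg[of c] by (simp add: mult_less_0_iff)
      moreover have "lam * real c \<le> lam * real c'" using lam_pos c(2) by simp
      ultimately have "real s + 2 - 2 * real c' - lam * real c' \<le> 0" using c(2) by linarith
      then have "(real s + 2 - 2 * real c') * u c' \<le> 0"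
        unfolding u using f_nonneg by (simp add: mult_nonneg_nonpos)
      then show ?thesis using p(1) by (simp add: mult_le_0_iff)
    qed
  qed (use assms in simp)
  then show ?thesis
    unfolding u_def sum_subtractf sum_distrib_left[symmetric] sum_g' flow_one_def .
qed

text \<open>Here \<open>ones\<close> relates the sign of \<open>lam * g c - f c\<close> to that of
  lam (s + 1 - 2c) - (n - s + c), again decreasing in c, as long as the number n - s + c of 0s is
  positive.\<close>

lemma flow_two_nonneg:
  assumes "b \<le> m" shows "0 \<le> flow_two b"
proof -
  define v where "v c = lam * g c - f c" for c
  have v: "(real n - real s + real c) * v c
      = f c * (lam * (real s + 1 - 2 * real c) - (real n - real s + real c))" for c
    using arg_cong[OF ones[of c], of "\<lambda>t. lam * t"] by (simp add: v_def algebra_simps)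
  have "0 \<le> (\<Sum>c<b. v c)"
  proof (rule partial_sum_nonneg)
    show "0 \<le> (\<Sum>c<m. v c)"
      unfolding v_def sum_subtractf sum_distrib_left[symmetric] total by simp
  next
    fix c c' assume c: "v c < 0" "c < c'" "c' < m"
    have f: "0 < f c"
      using c(1) mult_nonneg_nonneg[OF less_imp_le[OF lam_pos] g_nonneg[of c]] unfolding v_def by linarith
    show "v c' \<le> 0"
    proof (cases "s + 1 < 2 * c'")
      case True
      then show ?thesis using f_zero[of c'] g_zero[of c'] by (simp add: v_def)
    next
      case False
      then have p: "0 < real n - real s + real c" using positive_zeros[OF f] c(2) by simp
      have "f c * (lam * (real s + 1 - 2 * real c) - (real n - real s + real c)) < 0"
        unfolding v[symmetric] using p c(1) by (simp add: mult_pos_neg)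
      then have "lam * (real s + 1 - 2 * real c) - (real n - real s + real c) < 0"
        using f by (simp add: mult_less_0_iff)
      moreover have "lam * (real s + 1 - 2 * real c') \<le> lam * (real s + 1 - 2 * real c)"
        using lam_pos c(2) by simp
      ultimately have "lam * (real s + 1 - 2 * real c') - (real n - real s + real c') \<le> 0"
        using c(2) by linarith
      then have "(real n - real s + real c') * v c' \<le> 0"
        unfolding v using f_nonneg by (simp add: mult_nonneg_nonpos)
      then show ?thesis using p c(2) by (simp add: mult_le_0_iff)
    qed
  qed (use assms in simp)
  then show ?thesis
    unfolding v_def sum_subtractf sum_distrib_left[symmetric] flow_two_def .
qed

text \<open>For this bound and the next one, the slack is a partial sum of a sequence whose sign, up to a positive
  factor, is that of a convex quadratic \<open>Q\<close> vanishing at the right end of the range. Hence it changes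
  sign at most once, from plus to minus, and its total is 0.\<close>

lemma flow_one_le:
  assumes "b < m"
  shows "flow_one b \<le> 2 * lam / (2 * real n - real s) * ((real s + 1 - 2 * real b) * f b)"
proof -
  \<comment> \<open>A lower vector without a 1 has n - s/2 upper neighbours that together send it
    mass \<open>lam\<close>, which gives this value per edge. It is also the value for which
    \<open>Q\<close> vanishes at (s + 2) / 2.\<close>
  define \<tau> where "\<tau> = 2 * lam / (2 * real n - real s)"
  have \<tau>: "0 < \<tau>" "lam = \<tau> * (2 * real n - real s) / 2"
    using lam_pos s_less by (auto simp: \<tau>_def)
  define V where "V c = (real s + 1 - 2 * real c) * f c" for c
  define D where "D c = \<tau> * (V c - (if c = 0 then 0 else V (c - 1))) - (f c - lam * g' c)" for c
  define Q where "Q c = (\<tau> * (real s + 1 - 2 * c) - 1) * (real s + 2 - 2 * c)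
      + c * (lam - \<tau> * (real n - real s + c - 1))" for c
  have V': "(if c = 0 then 0 else V (c - 1)) = (real n - real s + real c - 1) * g' c" for c
    using ones'[of c] by (cases c) (auto simp: V_def g'_def algebra_simps)
  have D: "(real s + 2 - 2 * real c) * D c = f c * Q (real c)" for c
  proof -
    have "(real s + 2 - 2 * real c) * D c
        = \<tau> * (real s + 1 - 2 * real c) * (real s + 2 - 2 * real c) * f c
          - \<tau> * (real n - real s + real c - 1) * ((real s + 2 - 2 * real c) * g' c)
          - (real s + 2 - 2 * real c) * f c + lam * ((real s + 2 - 2 * real c) * g' c)"
      unfolding D_def V' unfolding V_def by (simp add: algebra_simps)
    also have "\<dots> = f c * Q (real c)"
      unfolding twos' Q_def by (simp add: algebra_simps)
    finally show ?thesis .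
  qed
  have sum_D: "(\<Sum>c<Suc j. D c) = \<tau> * V j - flow_one j" for j
  proof -
    have "(\<Sum>c<Suc j. V c - (if c = 0 then 0 else V (c - 1))) = V j"
      by (induction j) auto
    then show ?thesis
      unfolding D_def sum_subtractf sum_distrib_left[symmetric] sum_g' flow_one_def by simp
  qed
  have "0 \<le> (\<Sum>c<Suc b. D c)"
  proof (rule partial_sum_nonneg)
    obtain m' where m': "m = Suc m'" using assms by (cases m) auto
    then have "s + 1 < 2 * m'" using m_large by simp
    then have "V m' = 0" "flow_one m' = 0"
      using f_zero[of m'] g_zero[of m'] total by (auto simp: V_def flow_one_def m')
    then show "0 \<le> (\<Sum>c<m. D c)" unfolding m' sum_D by simp
  next
    fix c c' assume c: "D c < 0" "c < c'" "c' < m"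
    consider "s + 2 < 2 * c'" | "2 * c' = s + 2" | "2 * c' < s + 2" by linarith
    then show "D c' \<le> 0"
    proof cases
      case 1
      then have "f c' = 0" "g' c' = 0" using f_zero[of c'] g'_zero[of c'] by auto
      then show ?thesis unfolding D_def V' unfolding V_def by simp
    next
      \<comment> \<open>At the right end the factor s + 2 - 2c is zero, so \<open>Q\<close> says
        nothing about the sign of \<open>D c'\<close>. Instead, the choice of \<tau> makes the entry
        itself zero.\<close>
      case 2
      then have f: "f c' = 0" and r: "real c' = (real s + 2) / 2" using f_zero[of c'] by auto
      have "D c' = g' c' * (lam - \<tau> * (real n - real s + real c' - 1))"
        unfolding D_def V' unfolding V_def f by (simp add: algebra_simps)
      also have "lam - \<tau> * (real n - real s + real c' - 1) = 0"
        unfolding r \<tau>(2) by (simp add: field_simps)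
      finally show ?thesis by simp
    next
      case 3
      then have p: "0 < real s + 2 - 2 * real c'" "0 < real s + 2 - 2 * real c" using c(2) by auto
      have "f c * Q (real c) < 0"
        unfolding D[symmetric] using p(2) c(1) by (simp add: mult_pos_neg)
      then have qc: "Q (real c) < 0" using f_nonneg[of c] by (simp add: mult_less_0_iff)
      have q: "Q t = 3 * \<tau> * t\<^sup>2 + (lam + 2 - \<tau> * (3 * real s + 5 + real n)) * t
          + (\<tau> * (real s + 1) - 1) * (real s + 2)" for t
        unfolding Q_def by (simp add: algebra_simps power2_eq_square)
      have "lam - \<tau> * (real n - real s + (real s + 2) / 2 - 1) = 0"
        unfolding \<tau>(2) by (simp add: field_simps)
      then have qR: "Q ((real s + 2) / 2) = 0" unfolding Q_def by simp
      have "Q (real c') \<le> 0"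
        unfolding q
        by (rule convex_quadratic_nonpos[OF _ _ _ less_imp_le[OF qc[unfolded q]] eq_refl[OF qR[unfolded q]]])
          (use \<tau>(1) c(2) 3 in auto)
      then have "(real s + 2 - 2 * real c') * D c' \<le> 0"
        unfolding D using f_nonneg by (simp add: mult_nonneg_nonpos)
      then show ?thesis using p(1) by (simp add: mult_le_0_iff)
    qed
  qed (use assms in simp)
  then show ?thesis unfolding sum_D V_def \<tau>_def by simp
qed

lemma flow_two_le:
  assumes "b \<le> m"
  shows "flow_two b \<le> 2 / (real s + 1) * (real b * f b)"
proof -
  \<comment> \<open>An upper vector without a 1 sends mass 1 along only (s + 1) / 2 edges.\<close>
  define \<tau> where "\<tau> = 2 / (real s + 1)"
  have \<tau>: "0 < \<tau>" "\<tau> * (real s + 1) = 2" by (simp_all add: \<tau>_def field_simps)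
  define D where "D c = \<tau> * (real (Suc c) * f (Suc c) - real c * f c) - (lam * g c - f c)" for c
  define Q where "Q c = (real s + 1 - 2 * c) * (\<tau> * (real s - 2 * c) - lam)
      + (1 - \<tau> * c) * (real n - real s + c)" for c
  have W: "real (Suc c) * f (Suc c) = (real s - 2 * real c) * g c" for c
    using twos[of c] by (simp add: add.commute)
  have D: "(real n - real s + real c) * D c = f c * Q (real c)" for c
  proof -
    have "(real n - real s + real c) * D c
        = (\<tau> * (real s - 2 * real c) - lam) * ((real n - real s + real c) * g c)
          + (1 - \<tau> * real c) * (real n - real s + real c) * f c"
      unfolding D_def W by (simp add: algebra_simps)
    also have "\<dots> = f c * Q (real c)"
      unfolding ones[symmetric] Q_def by (simp add: algebra_simps)
    finally show ?thesis .
  qed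
  have sum_D: "(\<Sum>c<j. D c) = \<tau> * (real j * f j) - flow_two j" for j
  proof -
    have "(\<Sum>c<j. real (Suc c) * f (Suc c) - real c * f c) = real j * f j"
      by (induction j) auto
    then show ?thesis
      unfolding D_def sum_subtractf sum_distrib_left[symmetric] flow_two_def by simp
  qed
  have "0 \<le> (\<Sum>c<b. D c)"
  proof (rule partial_sum_nonneg)
    have "f m = 0" using f_zero[of m] m_large by simp
    then show "0 \<le> (\<Sum>c<m. D c)" unfolding sum_D flow_two_def total by simp
  next
    fix c c' assume c: "D c < 0" "c < c'" "c' < m"
    show "D c' \<le> 0"
    proof (cases "s + 1 < 2 * c'")
      case True
      then have "f c' = 0" "g c' = 0" using f_zero[of c'] g_zero[of c'] by auto
      then show ?thesis unfolding D_def W by simp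
    next
      case False
      then have c2: "2 * c < s + 1" using c(2) by simp
      \<comment> \<open>The sign of \<open>D c\<close> can be read off from \<open>Q\<close> only if
        lower vectors of type c have a 0. If they have none, \<open>lam_le\<close> makes
        \<open>D c\<close> nonnegative, against the assumption.\<close>
      have p: "0 < real n - real s + real c"
      proof (rule ccontr)
        assume np: "\<not> 0 < real n - real s + real c"
        then have f: "f c = 0" using positive_zeros[OF _ c2] f_nonneg[of c] by fastforce
        have "g c \<noteq> 0" using c(1) unfolding D_def W f by auto
        then have z: "real n - real s + real c = 0"
          using np g_zero_of_full[of c] by (cases "real n - real s + real c < 0") auto
        have "D c = g c * (\<tau> * (real s - 2 * real c) - lam)"
          unfolding D_def W f by (simp add: algebra_simps)
        moreover have "real s - 2 * real c = 2 * real n - real s" using z by linarith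
        moreover have "lam \<le> \<tau> * (2 * real n - real s)" using lam_le by (simp add: \<tau>_def)
        ultimately show False using c(1) g_nonneg[of c] by (simp add: mult_less_0_iff)
      qed
      have "f c * Q (real c) < 0"
        unfolding D[symmetric] using p c(1) by (simp add: mult_pos_neg)
      then have qc: "Q (real c) < 0" using f_nonneg[of c] by (simp add: mult_less_0_iff)
      have q: "Q t = 3 * \<tau> * t\<^sup>2 + (2 * lam + 1 - \<tau> * (3 * real s + 2 + real n)) * t
          + ((real s + 1) * (\<tau> * real s - lam) + (real n - real s))" for t
        unfolding Q_def by (simp add: algebra_simps power2_eq_square)
      have qR: "Q ((real s + 1) / 2) = 0" unfolding Q_def using \<tau>(2) by simp
      have "Q (real c') \<le> 0"
        unfolding q
        by (rule convex_quadratic_nonpos[OF _ _ _ less_imp_le[OF qc[unfolded q]] eq_refl[OF qR[unfolded q]]])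
          (use \<tau>(1) c(2) False in auto)
      then have "(real n - real s + real c') * D c' \<le> 0"
        unfolding D using f_nonneg by (simp add: mult_nonneg_nonpos)
      then show ?thesis using p c(2) by (simp add: mult_le_0_iff)
    qed
  qed (use assms in simp)
  then show ?thesis unfolding sum_D \<tau>_def by simp
qed

text \<open>The flow is spread evenly over its edges. If there are none, the quotient is 0 by
  convention, which agrees with the flow: \<open>flow_one_le\<close> then forces it to vanish. The
  same holds for \<open>prob_two\<close>.\<close>

definition prob_one :: "nat \<Rightarrow> real" where
  "prob_one b = flow_one b / ((real s + 1 - 2 * real b) * f b)"

definition prob_two :: "nat \<Rightarrow> real" where
  "prob_two b = flow_two b / (real b * f b)"

lemma prob_one_bounds:
  assumes "2 * b \<le> s"
  shows "0 \<le> prob_one b" "prob_one b \<le> 2 * lam / (2 * real n - real s)"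
proof -
  have b: "b < m" using assms m_large by simp
  have p: "0 \<le> (real s + 1 - 2 * real b) * f b"
    using assms f_nonneg by (intro mult_nonneg_nonneg) auto
  show "0 \<le> prob_one b" unfolding prob_one_def using flow_one_nonneg[OF b] p by simp
  show "prob_one b \<le> 2 * lam / (2 * real n - real s)"
  proof (cases "(real s + 1 - 2 * real b) * f b = 0")
    case True
    then show ?thesis unfolding prob_one_def True using lam_pos s_less by simp
  next
    case False
    with p have "0 < (real s + 1 - 2 * real b) * f b" by linarith
    then show ?thesis using flow_one_le[OF b] by (simp only: prob_one_def pos_divide_le_eq)
  qed
qed

lemma prob_two_bounds:
  assumes "2 * b \<le> s + 1"
  shows "0 \<le> prob_two b" "prob_two b \<le> 2 / (real s + 1)"
proof -
  have b: "b \<le> m" using assms m_large by simp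
  have p: "0 \<le> real b * f b" using f_nonneg by simp
  show "0 \<le> prob_two b" unfolding prob_two_def using flow_two_nonneg[OF b] p by simp
  show "prob_two b \<le> 2 / (real s + 1)"
  proof (cases "real b * f b = 0")
    case True
    then show ?thesis unfolding prob_two_def True by simp
  next
    case False
    with p have "0 < real b * f b" by linarith
    then show ?thesis using flow_two_le[OF b] by (simp only: prob_two_def pos_divide_le_eq)
  qed
qed

lemma row_total:
  assumes "0 < f b" "2 * b \<le> s + 1"
  shows "(real s + 1 - 2 * real b) * prob_one b + real b * prob_two b = 1"
proof -
  have b: "b < m" using assms m_large by simp
  have one: "(real s + 1 - 2 * real b) * prob_one b = flow_one b / f b"
  proof (cases "real s + 1 - 2 * real b = 0")
    case True
    then have "flow_one b = 0" using flow_one_le[OF b] flow_one_nonneg[OF b] by simp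
    then show ?thesis using True by simp
  qed (simp add: prob_one_def)
  have two: "real b * prob_two b = flow_two b / f b"
    by (cases "b = 0") (simp_all add: prob_two_def flow_two_def)
  have "flow_one b + flow_two b = f b" by (simp add: flow_one_def flow_two_def)
  then show ?thesis
    unfolding one two add_divide_distrib[symmetric] using assms(1) by simp
qed

lemma column_total:
  assumes "0 < g b" "2 * b \<le> s"
  shows "(real n - real s + real b) * prob_one b + (real s - 2 * real b) * prob_two (Suc b) = lam"
proof -
  have b: "b < m" "Suc b \<le> m" using assms m_large by auto
  have one: "(real n - real s + real b) * prob_one b = flow_one b / g b"
  proof (cases "real n - real s + real b = 0")
    case True
    then have "flow_one b = 0"
      using flow_one_le[OF b(1)] flow_one_nonneg[OF b(1)] unfolding ones by simp
    then show ?thesis using True by simp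
  qed (simp add: prob_one_def ones)
  have W: "real (Suc b) * f (Suc b) = (real s - 2 * real b) * g b"
    using twos[of b] by (simp add: add.commute)
  have two: "(real s - 2 * real b) * prob_two (Suc b) = flow_two (Suc b) / g b"
  proof (cases "real s - 2 * real b = 0")
    case True
    then have "flow_two (Suc b) = 0"
      using flow_two_le[OF b(2)] flow_two_nonneg[OF b(2)] unfolding W by simp
    then show ?thesis using True by simp
  qed (simp add: prob_two_def W del: of_nat_Suc)
  have "flow_one b + flow_two (Suc b) = lam * g b"
    by (simp add: flow_one_def flow_two_def algebra_simps)
  then show ?thesis
    unfolding one two add_divide_distrib[symmetric] using assms(1) by simp
qed

end

section \<open>The flow between the layers of the cube\<close>

definition layer_ratio :: "nat \<Rightarrow> nat \<Rightarrow> real" where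
  "layer_ratio n s = real (ell (Suc s) n) / real (ell s n)"

definition edge_one :: "nat \<Rightarrow> nat \<Rightarrow> nat \<Rightarrow> real" where
  "edge_one n s = adjacent_layers.prob_one s (\<lambda>b. real (twos_card n (Suc s) b))
     (\<lambda>b. real (twos_card n s b)) (layer_ratio n s)"

definition edge_two :: "nat \<Rightarrow> nat \<Rightarrow> nat \<Rightarrow> real" where
  "edge_two n s = adjacent_layers.prob_two (\<lambda>b. real (twos_card n (Suc s) b))
     (\<lambda>b. real (twos_card n s b)) (layer_ratio n s)"

lemma layer_ratio_pos: "s < 2 * n \<Longrightarrow> 0 < layer_ratio n s"
  using ell_pos[of s n] ell_pos[of "Suc s" n] by (simp add: layer_ratio_def)

lemma layer_ratio_upper:
  assumes "s < 2 * n" shows "real (min (Suc s) n) * layer_ratio n s \<le> 2 * real n - real s"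
proof -
  have "real (min (Suc s) n * ell (Suc s) n) \<le> real ((2 * n - s) * ell s n)"
    using ell_ratio_upper[OF assms] by (simp only: of_nat_le_iff)
  then show ?thesis
    using assms ell_pos[of s n] by (simp add: layer_ratio_def of_nat_diff pos_divide_le_eq)
qed

lemma layer_ratio_lower:
  assumes "s < 2 * n" shows "real (min (2 * n - s) n) \<le> (real s + 1) * layer_ratio n s"
proof -
  have "real (min (2 * n - s) n * ell s n) \<le> real (Suc s * ell (Suc s) n)"
    using ell_ratio_lower[OF assms] by (simp only: of_nat_le_iff)
  then show ?thesis
    using assms ell_pos[of s n] by (simp add: layer_ratio_def pos_le_divide_eq algebra_simps)
qed

lemma adjacent_layers_twos_card:
  assumes "s < 2 * n"
  shows "adjacent_layers n s (s + 3) (\<lambda>b. real (twos_card n (Suc s) b))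
     (\<lambda>b. real (twos_card n s b)) (layer_ratio n s)"
proof
  show "0 < layer_ratio n s" using assms by (rule layer_ratio_pos)
  have "(\<Sum>b<s + 3. twos_card n (Suc s) b) = ell (Suc s) n" "(\<Sum>b<s + 3. twos_card n s b) = ell s n"
    by (rule sum_twos_card, simp)+
  then show "(\<Sum>b<s + 3. real (twos_card n (Suc s) b)) = layer_ratio n s * (\<Sum>b<s + 3. real (twos_card n s b))"
    unfolding of_nat_sum[symmetric] using assms ell_pos[of s n] by (simp add: layer_ratio_def)
  have "real (Suc s) / 2 \<le> real (min (Suc s) n)" using assms by (simp add: min_def)
  then have "real (Suc s) / 2 * layer_ratio n s \<le> real (min (Suc s) n) * layer_ratio n s"
    using layer_ratio_pos[OF assms] by (intro mult_right_mono) auto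
  also have "\<dots> \<le> 2 * real n - real s" by (rule layer_ratio_upper[OF assms])
  finally show "layer_ratio n s \<le> 2 * (2 * real n - real s) / (real s + 1)"
    by (simp add: field_simps)
qed (use assms twos_card_ones[of s _ n] twos_card_twos[of _ n s] in \<open>simp_all add: twos_card_zero\<close>)

lemma edge_one_bounds:
  assumes "s < 2 * n" "2 * b \<le> s"
  shows "0 \<le> edge_one n s b" "edge_one n s b \<le> 2 * layer_ratio n s / (2 * real n - real s)"
  unfolding edge_one_def
  using adjacent_layers.prob_one_bounds[OF adjacent_layers_twos_card[OF assms(1)] assms(2)] by auto

lemma edge_two_bounds:
  assumes "s < 2 * n" "2 * b \<le> s + 1"
  shows "0 \<le> edge_two n s b" "edge_two n s b \<le> 2 / (real s + 1)"
  unfolding edge_two_def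
  using adjacent_layers.prob_two_bounds[OF adjacent_layers_twos_card[OF assms(1)] assms(2)] by auto

section \<open>The descending Markov chain\<close>

text \<open>Written as a sum over coordinates, of which at most one contributes, so that row and
  column sums follow by exchanging sums. The index \<open>weight n x - 1\<close> is the rank of the
  target.\<close>

definition down_step :: "nat \<Rightarrow> (nat \<Rightarrow> nat) \<Rightarrow> (nat \<Rightarrow> nat) \<Rightarrow> real" where
  "down_step n x y = (\<Sum>j<n. if x j = 1 \<and> y = x(j := 0) then edge_one n (weight n x - 1) (mult_of 2 n x)
     else if x j = 2 \<and> y = x(j := 1) then edge_two n (weight n x - 1) (mult_of 2 n x) else 0)"

definition covers :: "nat \<Rightarrow> (nat \<Rightarrow> nat) \<Rightarrow> (nat \<Rightarrow> nat) \<Rightarrow> bool" where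
  "covers n x y \<longleftrightarrow> (\<exists>j<n. 0 < x j \<and> y = x(j := x j - 1))"

lemma down_step_zero: "\<not> covers n x y \<Longrightarrow> down_step n x y = 0"
  unfolding down_step_def covers_def by (rule sum.neutral) auto

lemma covers_weight:
  assumes "covers n x y" shows "weight n x = Suc (weight n y)"
proof -
  obtain j where "j < n" "0 < x j" "y = x(j := x j - 1)" using assms by (auto simp: covers_def)
  then show ?thesis using weight_upd[of j n x "x j - 1"] by simp
qed

lemma covers_le: "covers n x y \<Longrightarrow> y j \<le> x j"
  unfolding covers_def by auto

lemma down_step_eq:
  assumes "j < n" "0 < x j" "y = x(j := x j - 1)"
  shows "down_step n x y = (if x j = 1 then edge_one n (weight n x - 1) (mult_of 2 n x)
     else if x j = 2 then edge_two n (weight n x - 1) (mult_of 2 n x) else 0)"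
proof -
  have ne: "\<not> (x i = 1 \<and> y = x(i := 0))" "\<not> (x i = 2 \<and> y = x(i := 1))" if "i \<noteq> j" for i
  proof -
    have "y j \<noteq> x j" using assms by simp
    then show "\<not> (x i = 1 \<and> y = x(i := 0))" "\<not> (x i = 2 \<and> y = x(i := 1))"
      using that by (auto simp: fun_eq_iff)
  qed
  have "down_step n x y = (\<Sum>i<n. if i = j then (if x j = 1 then edge_one n (weight n x - 1) (mult_of 2 n x)
     else if x j = 2 then edge_two n (weight n x - 1) (mult_of 2 n x) else 0) else 0)"
    unfolding down_step_def
  proof (rule sum.cong)
    fix i
    show "(if x i = 1 \<and> y = x(i := 0) then edge_one n (weight n x - 1) (mult_of 2 n x)
        else if x i = 2 \<and> y = x(i := 1) then edge_two n (weight n x - 1) (mult_of 2 n x) else 0)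
      = (if i = j then (if x j = 1 then edge_one n (weight n x - 1) (mult_of 2 n x)
          else if x j = 2 then edge_two n (weight n x - 1) (mult_of 2 n x) else 0) else 0)"
    proof (cases "i = j")
      case True
      then show ?thesis using assms(3) by auto
    next
      case False
      then show ?thesis by (simp only: ne[OF False] if_False)
    qed
  qed simp
  then show ?thesis using assms(1) by simp
qed

lemma mult_of_pos:
  assumes "j < n" "x j = c" shows "0 < mult_of c n x"
proof -
  have "(if x j = c then 1 else 0) \<le> mult_of c n x"
    unfolding mult_of_def by (rule member_le_sum) (use assms in auto)
  then show ?thesis using assms by simp
qed

lemma down_step_cases:
  assumes "x \<in> ternary_cube n" "covers n x y"
  obtains s where "weight n x = Suc s" "s < 2 * n" "0 \<le> down_step n x y"
    "down_step n x y \<le> 2 * layer_ratio n s / (2 * real n - real s) \<or> down_step n x y \<le> 2 / (real s + 1)"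
proof -
  obtain j where j: "j < n" "0 < x j" "y = x(j := x j - 1)" using assms(2) by (auto simp: covers_def)
  obtain s where s: "weight n x = Suc s" using covers_weight[OF assms(2)] by blast
  have s2: "s < 2 * n" using weight_le[OF assms(1)] s by simp
  have b: "mult_of 1 n x + 2 * mult_of 2 n x = Suc s" using weight_mult_of[OF assms(1)] s by simp
  have d: "down_step n x y = (if x j = 1 then edge_one n s (mult_of 2 n x)
     else if x j = 2 then edge_two n s (mult_of 2 n x) else 0)"
    using down_step_eq[OF j] unfolding s diff_Suc_1 .
  have "x j = 1 \<or> x j = 2" using cube_value[OF assms(1), of j] j(2) by auto
  then show ?thesis
  proof
    assume "x j = 1"
    then have b2: "2 * mult_of 2 n x \<le> s" using mult_of_pos[OF j(1), of x 1] b by simp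
    have "down_step n x y = edge_one n s (mult_of 2 n x)" using d \<open>x j = 1\<close> by simp
    then show ?thesis using that[OF s s2] edge_one_bounds[OF s2 b2] by metis
  next
    assume "x j = 2"
    have b2: "2 * mult_of 2 n x \<le> s + 1" using b by simp
    have "down_step n x y = edge_two n s (mult_of 2 n x)" using d \<open>x j = 2\<close> by simp
    then show ?thesis using that[OF s s2] edge_two_bounds[OF s2 b2] by metis
  qed
qed

lemma down_step_nonneg: "x \<in> ternary_cube n \<Longrightarrow> 0 \<le> down_step n x y"
  by (cases "covers n x y") (auto elim: down_step_cases simp: down_step_zero)

lemma down_step_le:
  assumes "x \<in> ternary_cube n"
  shows "down_step n x y \<le> 2 / real (min (weight n x) n)"
proof (cases "covers n x y")
  case True
  obtain s where s: "weight n x = Suc s" "s < 2 * n"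
    and d: "down_step n x y \<le> 2 * layer_ratio n s / (2 * real n - real s) \<or> down_step n x y \<le> 2 / (real s + 1)"
    using down_step_cases[OF assms True] by blast
  have m: "0 < real (min (Suc s) n)" using s by simp
  have "2 * layer_ratio n s / (2 * real n - real s) \<le> 2 / real (min (Suc s) n)"
  proof -
    have "layer_ratio n s * real (min (Suc s) n) \<le> 2 * real n - real s" "0 < 2 * real n - real s"
      using layer_ratio_upper[OF s(2)] s(2) by (auto simp: mult.commute)
    then show ?thesis using m by (simp add: pos_le_divide_eq pos_divide_le_eq)
  qed
  moreover have "2 / (real s + 1) \<le> 2 / real (min (Suc s) n)"
    using m by (intro divide_left_mono) auto
  ultimately show ?thesis using d s by fastforce
qed (simp add: down_step_zero)

text \<open>Division by \<open>layer_ratio n s\<close> gives the transition probability of the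
  reversed chain, whose step starts at rank 2n - s after complementation. So this is the bound 2 /
  min(r, n) for that chain.\<close>

lemma down_step_le_reverse:
  assumes "x \<in> ternary_cube n" "weight n x = Suc s"
  shows "down_step n x y \<le> layer_ratio n s * (2 / real (min (2 * n - s) n))"
proof (cases "covers n x y")
  case True
  have s: "s < 2 * n"
    and d: "down_step n x y \<le> 2 * layer_ratio n s / (2 * real n - real s) \<or> down_step n x y \<le> 2 / (real s + 1)"
    using down_step_cases[OF assms(1) True] assms(2) by auto
  have m: "0 < real (min (2 * n - s) n)" using s by simp
  have p: "0 < layer_ratio n s" by (rule layer_ratio_pos[OF s])
  have "2 * layer_ratio n s / (2 * real n - real s) \<le> layer_ratio n s * (2 / real (min (2 * n - s) n))"
  proof -
    have "real (min (2 * n - s) n) \<le> 2 * real n - real s" using s by simp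
    then have "2 / (2 * real n - real s) \<le> 2 / real (min (2 * n - s) n)"
      using m by (intro divide_left_mono) auto
    then have "layer_ratio n s * (2 / (2 * real n - real s)) \<le> layer_ratio n s * (2 / real (min (2 * n - s) n))"
      using p by (intro mult_left_mono) auto
    then show ?thesis by (simp add: mult.commute)
  qed
  moreover have "2 / (real s + 1) \<le> layer_ratio n s * (2 / real (min (2 * n - s) n))"
    using layer_ratio_lower[OF s] m by (simp add: pos_le_divide_eq pos_divide_le_eq mult.commute)
  ultimately show ?thesis using d by (elim disjE) (rule order_trans, assumption, assumption)+
next
  case False
  have "0 \<le> layer_ratio n s" by (simp add: layer_ratio_def)
  then show ?thesis by (simp add: False down_step_zero)
qed

lemma sum_by_value:
  assumes "u \<noteq> v"
  shows "(\<Sum>j<n. if x j = u then A else if x j = v then B else 0)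
    = real (mult_of u n x) * A + real (mult_of v n x) * B"
  using assms by (induction n) (auto simp: mult_of_def algebra_simps)

lemma twos_card_pos: "x \<in> ternary_cube n \<Longrightarrow> 0 < twos_card n (weight n x) (mult_of 2 n x)"
  unfolding twos_card_def card_gt_0_iff by (auto simp: twos_class_def layer_def)

lemma sum_down_step_row:
  assumes "x \<in> ternary_cube n" "weight n x = Suc s"
  shows "(\<Sum>y\<in>ternary_cube n. down_step n x y) = 1"
proof -
  let ?b = "mult_of 2 n x"
  have s: "s < 2 * n" using weight_le[OF assms(1)] assms(2) by simp
  have one: "mult_of 1 n x + 2 * ?b = Suc s" using weight_mult_of[OF assms(1)] assms(2) by simp
  have "(\<Sum>y\<in>ternary_cube n. down_step n x y)
      = (\<Sum>j<n. \<Sum>y\<in>ternary_cube n. if x j = 1 \<and> y = x(j := 0) then edge_one n s ?b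
           else if x j = 2 \<and> y = x(j := 1) then edge_two n s ?b else 0)"
    unfolding down_step_def assms(2) diff_Suc_1 by (rule sum.swap)
  also have "\<dots> = (\<Sum>j<n. if x j = 1 then edge_one n s ?b else if x j = 2 then edge_two n s ?b else 0)"
  proof (rule sum.cong)
    fix j assume "j \<in> {..<n}"
    then have "x(j := 0) \<in> ternary_cube n" "x(j := 1) \<in> ternary_cube n"
      using assms(1) by (auto intro!: cube_upd)
    then show "(\<Sum>y\<in>ternary_cube n. if x j = 1 \<and> y = x(j := 0) then edge_one n s ?b
           else if x j = 2 \<and> y = x(j := 1) then edge_two n s ?b else 0)
        = (if x j = 1 then edge_one n s ?b else if x j = 2 then edge_two n s ?b else 0)"
      by (cases "x j = 1"; cases "x j = 2") (simp_all add: sum.delta cong: if_cong)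
  qed simp
  also have "\<dots> = real (mult_of 1 n x) * edge_one n s ?b + real ?b * edge_two n s ?b"
    by (rule sum_by_value) simp
  also have "real (mult_of 1 n x) = real s + 1 - 2 * real ?b" using one by linarith
  also have "(real s + 1 - 2 * real ?b) * edge_one n s ?b + real ?b * edge_two n s ?b = 1"
    unfolding edge_one_def edge_two_def
    by (rule adjacent_layers.row_total[OF adjacent_layers_twos_card[OF s]])
      (use twos_card_pos[OF assms(1)] assms(2) one in auto)
  finally show ?thesis .
qed

lemma sum_down_step_column:
  assumes "y \<in> ternary_cube n" "weight n y = s" "s < 2 * n"
  shows "(\<Sum>x\<in>ternary_cube n. down_step n x y) = layer_ratio n s"
proof -
  let ?b = "mult_of 2 n y"
  let ?t = "\<lambda>j x. if x j = 1 \<and> y = x(j := 0) then edge_one n (weight n x - 1) (mult_of 2 n x)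
           else if x j = 2 \<and> y = x(j := 1) then edge_two n (weight n x - 1) (mult_of 2 n x) else 0"
  have one: "mult_of 1 n y + 2 * ?b = s" using weight_mult_of[OF assms(1)] assms(2) by simp
  have "(\<Sum>x\<in>ternary_cube n. down_step n x y) = (\<Sum>j<n. \<Sum>x\<in>ternary_cube n. ?t j x)"
    unfolding down_step_def by (rule sum.swap)
  also have "\<dots> = (\<Sum>j<n. if y j = 0 then edge_one n s ?b else if y j = 1 then edge_two n s (Suc ?b) else 0)"
  proof (rule sum.cong)
    fix j assume "j \<in> {..<n}"
    then have j: "j < n" by simp
    let ?u = "y(j := Suc (y j))"
    let ?e = "if y j = 0 then edge_one n s ?b else if y j = 1 then edge_two n s (Suc ?b) else 0"
    have w: "weight n ?u - 1 = s" using weight_upd[OF j, of y "Suc (y j)"] assms(2) by simp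
    have m: "y j = 0 \<Longrightarrow> mult_of 2 n ?u = ?b" "y j = 1 \<Longrightarrow> mult_of 2 n ?u = Suc ?b"
      using mult_of_upd[OF j, of 2 y "Suc (y j)"] by auto
    have "?t j x = (if x = ?u then ?e else 0)" for x
    proof (cases "x = ?u")
      case True
      have "y(j := 0) = y \<longleftrightarrow> y j = 0" "y(j := Suc 0) = y \<longleftrightarrow> y j = Suc 0"
        by (auto simp: fun_upd_idem_iff)
      then show ?thesis unfolding True using w m by auto
    qed auto
    then have "(\<Sum>x\<in>ternary_cube n. ?t j x) = (\<Sum>x\<in>ternary_cube n. if x = ?u then ?e else 0)" by simp
    also have "\<dots> = ?e"
      using cube_upd[OF assms(1) j, of "Suc (y j)"] by (auto simp: sum.delta)
    finally show "(\<Sum>x\<in>ternary_cube n. ?t j x) = ?e" .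
  qed simp
  also have "\<dots> = real (mult_of 0 n y) * edge_one n s ?b + real (mult_of 1 n y) * edge_two n s (Suc ?b)"
    by (rule sum_by_value) simp
  also have "real (mult_of 1 n y) = real s - 2 * real ?b" using one by linarith
  also have "real (mult_of 0 n y) = real n - real s + real ?b"
    using mult_of_total[OF assms(1)] one by linarith
  also have "(real n - real s + real ?b) * edge_one n s ?b + (real s - 2 * real ?b) * edge_two n s (Suc ?b)
      = layer_ratio n s"
    unfolding edge_one_def edge_two_def
    by (rule adjacent_layers.column_total[OF adjacent_layers_twos_card[OF assms(3)]])
      (use twos_card_pos[OF assms(1)] assms(2) one in auto)
  finally show ?thesis .
qed

section \<open>Visits of a Markov chain\<close>

primrec kernel_power :: "'a set \<Rightarrow> ('a \<Rightarrow> 'a \<Rightarrow> real) \<Rightarrow> nat \<Rightarrow> 'a \<Rightarrow> 'a \<Rightarrow> real" where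
  "kernel_power V K 0 x y = (if x = y then 1 else 0)"
| "kernel_power V K (Suc d) x y = (\<Sum>z\<in>V. K x z * kernel_power V K d z y)"

text \<open>The mass at \<open>y\<close> at time \<open>t\<close> that was outside \<open>S\<close>
  at all earlier times; \<open>y\<close> itself may lie in \<open>S\<close>, which then is a first
  visit.\<close>

primrec avoiding_mass :: "'a set \<Rightarrow> ('a \<Rightarrow> 'a \<Rightarrow> real) \<Rightarrow> 'a set \<Rightarrow> ('a \<Rightarrow> real) \<Rightarrow> nat \<Rightarrow> 'a \<Rightarrow> real" where
  "avoiding_mass V K S u 0 y = u y"
| "avoiding_mass V K S u (Suc t) y = (\<Sum>x\<in>V - S. avoiding_mass V K S u t x * K x y)"

locale substochastic_kernel =
  fixes V :: "'a set" and K :: "'a \<Rightarrow> 'a \<Rightarrow> real"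
  assumes finite_V: "finite V"
    and K_nonneg: "x \<in> V \<Longrightarrow> 0 \<le> K x y"
    and K_row: "x \<in> V \<Longrightarrow> (\<Sum>y\<in>V. K x y) \<le> 1"
begin

abbreviation "Kp \<equiv> kernel_power V K"

lemma Kp_nonneg: "x \<in> V \<Longrightarrow> 0 \<le> Kp d x y"
  by (induction d arbitrary: x) (auto intro!: sum_nonneg mult_nonneg_nonneg K_nonneg)

lemma Kp_add: "x \<in> V \<Longrightarrow> Kp (d + m) x y = (\<Sum>z\<in>V. Kp d x z * Kp m z y)"
proof (induction d arbitrary: x)
  case 0
  have "(\<Sum>z\<in>V. Kp 0 x z * Kp m z y) = (\<Sum>z\<in>V. if x = z then Kp m z y else 0)"
    by (rule sum.cong) auto
  then show ?case using 0 finite_V by simp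
next
  case (Suc d)
  have "Kp (Suc d + m) x y = (\<Sum>w\<in>V. K x w * (\<Sum>z\<in>V. Kp d w z * Kp m z y))"
    using Suc.IH by simp
  also have "\<dots> = (\<Sum>z\<in>V. (\<Sum>w\<in>V. K x w * Kp d w z) * Kp m z y)"
    unfolding sum_distrib_left sum_distrib_right by (subst sum.swap) (simp add: mult.assoc)
  finally show ?case by simp
qed

lemma Kp_1: "y \<in> V \<Longrightarrow> Kp 1 x y = K x y"
proof -
  assume y: "y \<in> V"
  have "(\<Sum>z\<in>V. K x z * (if z = y then 1 else 0)) = (\<Sum>z\<in>V. if z = y then K x z else 0)"
    by (rule sum.cong) auto
  then show ?thesis using y finite_V by simp
qed

lemma Kp_Suc_right: "x \<in> V \<Longrightarrow> y \<in> V \<Longrightarrow> Kp (Suc d) x y = (\<Sum>z\<in>V. Kp d x z * K z y)"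
  using Kp_add[of x d 1 y] by (simp only: Kp_1 Suc_eq_plus1)

lemma Kp_row: "x \<in> V \<Longrightarrow> (\<Sum>y\<in>V. Kp d x y) \<le> 1"
proof (induction d arbitrary: x)
  case (Suc d)
  have "(\<Sum>y\<in>V. Kp (Suc d) x y) = (\<Sum>z\<in>V. K x z * (\<Sum>y\<in>V. Kp d z y))"
    unfolding kernel_power.simps sum_distrib_left by (rule sum.swap)
  also have "\<dots> \<le> (\<Sum>z\<in>V. K x z * 1)"
    using Suc K_nonneg by (intro sum_mono mult_left_mono) auto
  also have "\<dots> \<le> 1" using K_row Suc.prems by simp
  finally show ?case .
qed (simp add: finite_V)

text \<open>The first \<open>d\<close> steps only average the bound for the last \<open>m\<close>,
  with total weight at most 1.\<close>

lemma Kp_add_le: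
  assumes "x \<in> V" "\<And>z. z \<in> V \<Longrightarrow> Kp m z y \<le> B" "0 \<le> B"
  shows "Kp (d + m) x y \<le> B"
proof -
  have "Kp (d + m) x y \<le> (\<Sum>z\<in>V. Kp d x z * B)"
    unfolding Kp_add[OF assms(1)] using assms Kp_nonneg by (intro sum_mono mult_left_mono) auto
  also have "\<dots> = (\<Sum>z\<in>V. Kp d x z) * B" by (rule sum_distrib_right[symmetric])
  also have "\<dots> \<le> 1 * B" using Kp_row assms by (intro mult_right_mono) auto
  finally show ?thesis by simp
qed

text \<open>A Bonferroni inequality for the set of times at which the chain visits \<open>S\<close>, obtained by
  following only the mass that has not met \<open>S\<close> yet.\<close>

lemma visits_bound:
  assumes S: "S \<subseteq> V" and Q_nonneg: "\<And>t x. 0 \<le> Q t x" and Q_0: "(\<Sum>x\<in>V. Q 0 x) \<le> 1"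
    and Q_Suc: "\<And>t y. y \<in> V \<Longrightarrow> Q (Suc t) y = (\<Sum>x\<in>V. Q t x * K x y)"
  shows "(\<Sum>t<m. \<Sum>y\<in>S. Q t y)
    \<le> 1 + (\<Sum>t<m. \<Sum>s<t. \<Sum>x\<in>S. \<Sum>y\<in>S. Q s x * Kp (t - s) x y)"
proof -
  define u where "u = avoiding_mass V K S (Q 0)"
  have u_Suc: "u (Suc t) y = (\<Sum>x\<in>V - S. u t x * K x y)" for t y by (simp add: u_def)
  have fin: "finite S" "finite (V - S)" using S finite_V by (auto intro: finite_subset)
  have split: "sum f V = sum f S + sum f (V - S)" for f :: "'a \<Rightarrow> real"
    using sum.subset_diff[OF S finite_V, of f] by simp
  have u_nonneg: "0 \<le> u t y" for t y
  proof (induction t arbitrary: y)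
    case (Suc t)
    then show ?case unfolding u_Suc by (auto intro!: sum_nonneg mult_nonneg_nonneg K_nonneg)
  qed (simp add: u_def Q_nonneg)
  \<comment> \<open>Mass that arrives at \<open>y\<close> either has avoided \<open>S\<close> so far
    or has visited some \<open>x\<close> in \<open>S\<close> at an earlier time \<open>s\<close>;
    the second part is bounded by a union bound over \<open>s\<close> and \<open>x\<close>.\<close>
  have Q_le: "Q t y \<le> u t y + (\<Sum>s<t. \<Sum>x\<in>S. Q s x * Kp (t - s) x y)" if "y \<in> V" for t y
    using that
  proof (induction t arbitrary: y)
    case (Suc t)
    define c where "c w = (\<Sum>s<t. \<Sum>x\<in>S. Q s x * Kp (t - s) x w)" for w
    have c_nonneg: "0 \<le> c w" for w
      unfolding c_def using S by (auto intro!: sum_nonneg mult_nonneg_nonneg Q_nonneg Kp_nonneg)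
    have "(\<Sum>x\<in>V - S. Q t x * K x y) \<le> (\<Sum>x\<in>V - S. (u t x + c x) * K x y)"
      using Suc.IH K_nonneg unfolding c_def by (intro sum_mono mult_right_mono) auto
    also have "\<dots> = u (Suc t) y + (\<Sum>x\<in>V - S. c x * K x y)"
      unfolding u_Suc distrib_right sum.distrib ..
    also have "(\<Sum>x\<in>V - S. c x * K x y) \<le> (\<Sum>x\<in>V. c x * K x y)"
      using finite_V c_nonneg K_nonneg by (intro sum_mono2) (auto intro!: mult_nonneg_nonneg)
    also have "(\<Sum>x\<in>V. c x * K x y) = (\<Sum>s<t. \<Sum>x\<in>S. Q s x * (\<Sum>w\<in>V. Kp (t - s) x w * K w y))"
    proof -
      have "(\<Sum>w\<in>V. c w * K w y) = (\<Sum>w\<in>V. \<Sum>s<t. \<Sum>x\<in>S. Q s x * Kp (t - s) x w * K w y)"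
        unfolding c_def sum_distrib_right ..
      also have "\<dots> = (\<Sum>s<t. \<Sum>w\<in>V. \<Sum>x\<in>S. Q s x * Kp (t - s) x w * K w y)" by (rule sum.swap)
      also have "\<dots> = (\<Sum>s<t. \<Sum>x\<in>S. \<Sum>w\<in>V. Q s x * Kp (t - s) x w * K w y)"
        by (rule sum.cong[OF refl], rule sum.swap)
      finally show ?thesis unfolding sum_distrib_left by (simp add: mult.assoc)
    qed
    also have "\<dots> = (\<Sum>s<t. \<Sum>x\<in>S. Q s x * Kp (Suc t - s) x y)"
    proof (intro sum.cong refl)
      fix s x assume "s \<in> {..<t}" "x \<in> S"
      then have "Suc t - s = Suc (t - s)" "x \<in> V" using S by auto
      then show "Q s x * (\<Sum>w\<in>V. Kp (t - s) x w * K w y) = Q s x * Kp (Suc t - s) x y"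
        using Kp_Suc_right[OF _ Suc.prems, of x "t - s"] by (simp del: kernel_power.simps)
    qed
    finally have "(\<Sum>x\<in>V - S. Q t x * K x y)
        \<le> u (Suc t) y + (\<Sum>s<t. \<Sum>x\<in>S. Q s x * Kp (Suc t - s) x y)" by simp
    moreover have "(\<Sum>x\<in>S. Q t x * K x y) = (\<Sum>x\<in>S. Q t x * Kp (Suc t - t) x y)"
      using Kp_1[OF Suc.prems] by (simp del: kernel_power.simps)
    ultimately show ?case
      unfolding Q_Suc[OF Suc.prems] split[of "\<lambda>x. Q t x * K x y"] sum.lessThan_Suc by linarith
  qed (simp add: u_def)
  \<comment> \<open>First visits to \<open>S\<close> at different times are disjoint events, and the
    last sum is the mass still being followed.\<close>
  have mass: "(\<Sum>t<m. \<Sum>y\<in>S. u t y) + (\<Sum>y\<in>V. u m y) \<le> 1"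
  proof (induction m)
    case (Suc m)
    have "(\<Sum>y\<in>V. u (Suc m) y) = (\<Sum>x\<in>V - S. u m x * (\<Sum>y\<in>V. K x y))"
      unfolding u_Suc sum_distrib_left by (rule sum.swap)
    also have "\<dots> \<le> (\<Sum>x\<in>V - S. u m x * 1)"
      using K_row u_nonneg by (intro sum_mono mult_left_mono) auto
    finally show ?case using Suc split[of "u m"] by simp
  qed (use Q_0 in \<open>simp add: u_def\<close>)
  have "(\<Sum>t<m. \<Sum>y\<in>S. Q t y)
      \<le> (\<Sum>t<m. \<Sum>y\<in>S. u t y + (\<Sum>s<t. \<Sum>x\<in>S. Q s x * Kp (t - s) x y))"
    using S by (intro sum_mono Q_le) auto
  also have "\<dots> = (\<Sum>t<m. \<Sum>y\<in>S. u t y) + (\<Sum>t<m. \<Sum>y\<in>S. \<Sum>s<t. \<Sum>x\<in>S. Q s x * Kp (t - s) x y)"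
    unfolding sum.distrib ..
  also have "(\<Sum>t<m. \<Sum>y\<in>S. \<Sum>s<t. \<Sum>x\<in>S. Q s x * Kp (t - s) x y)
      = (\<Sum>t<m. \<Sum>s<t. \<Sum>x\<in>S. \<Sum>y\<in>S. Q s x * Kp (t - s) x y)"
    by (rule sum.cong[OF refl], subst sum.swap, rule sum.cong[OF refl], rule sum.swap)
  also have "(\<Sum>t<m. \<Sum>y\<in>S. u t y) \<le> 1"
    using mass sum_nonneg[of V "u m"] u_nonneg by (simp add: add_increasing2)
  finally show ?thesis by simp
qed

end

section \<open>Distant pairs\<close>

text \<open>Collects what the chain and its reversal have in common, so that the pair estimates are
  proved once for both.\<close>

locale down_kernel = substochastic_kernel "ternary_cube n" K
  for n :: nat and K :: "(nat \<Rightarrow> nat) \<Rightarrow> (nat \<Rightarrow> nat) \<Rightarrow> real" +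
  assumes K_covers: "x \<in> ternary_cube n \<Longrightarrow> y \<in> ternary_cube n \<Longrightarrow> \<not> covers n x y \<Longrightarrow> K x y = 0"
    and K_le: "x \<in> ternary_cube n \<Longrightarrow> y \<in> ternary_cube n \<Longrightarrow> K x y \<le> 2 / real (min (weight n x) n)"
begin

lemma Kp_support:
  assumes "x \<in> ternary_cube n" "y \<in> ternary_cube n" "Kp d x y \<noteq> 0"
  shows "weight n x = weight n y + d \<and> (\<forall>j. y j \<le> x j)"
  using assms(1,3)
proof (induction d arbitrary: x)
  case (Suc d)
  from Suc.prems(2) obtain z where z: "z \<in> ternary_cube n" "K x z * Kp d z y \<noteq> 0"
    unfolding kernel_power.simps by (rule sum.not_neutral_contains_not_neutral)
  then have "covers n x z" "Kp d z y \<noteq> 0" using K_covers[OF Suc.prems(1) z(1)] by auto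
  then show ?case
    using Suc.IH[OF z(1)] covers_weight[of n x z] le_trans[OF _ covers_le[of n x z]] by simp
qed (auto split: if_splits)

text \<open>A step from \<open>x\<close> that stays above \<open>y\<close> lowers a coordinate in
  which \<open>x\<close> exceeds \<open>y\<close>, and each such coordinate contributes at least 1
  to the difference of the ranks.\<close>

lemma card_between_le:
  assumes "y \<in> ternary_cube n"
  shows "card {z \<in> ternary_cube n. covers n x z \<and> (\<forall>j. y j \<le> z j)} \<le> weight n x - weight n y"
    (is "card ?Z \<le> _")
proof (cases "\<forall>j. y j \<le> x j")
  case True
  let ?J = "{j. j < n \<and> y j < x j}"
  have "?Z \<subseteq> (\<lambda>j. x(j := x j - 1)) ` ?J"
  proof
    fix z assume z: "z \<in> ?Z"
    then obtain j where j: "j < n" "0 < x j" "z = x(j := x j - 1)" by (auto simp: covers_def)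
    have "y j \<le> z j" using z by simp
    then show "z \<in> (\<lambda>j. x(j := x j - 1)) ` ?J" using j by (intro image_eqI[of _ _ j]) auto
  qed
  then have "card ?Z \<le> card ?J" by (rule surj_card_le[rotated]) simp
  also have "\<dots> = (\<Sum>j\<in>?J. 1)" by simp
  also have "\<dots> \<le> (\<Sum>j\<in>?J. x j - y j)" by (rule sum_mono) auto
  also have "\<dots> \<le> (\<Sum>j<n. x j - y j)" by (rule sum_mono2) auto
  also have "\<dots> = weight n x - weight n y"
    unfolding weight_def using True by (intro sum_subtractf_nat) auto
  finally show ?thesis .
next
  case False
  then have "?Z = {}" by (auto dest: covers_le intro: le_trans)
  then show ?thesis by (simp only: card.empty le0)
qed

lemma Kp_le_fact:
  assumes y: "y \<in> ternary_cube n" and "0 \<le> \<tau>"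
    and \<tau>: "\<And>x z. x \<in> ternary_cube n \<Longrightarrow> z \<in> ternary_cube n \<Longrightarrow> weight n y < weight n x \<Longrightarrow> K x z \<le> \<tau>"
    and "x \<in> ternary_cube n"
  shows "Kp m x y \<le> fact m * \<tau> ^ m"
  using assms(4)
proof (induction m arbitrary: x)
  case (Suc m)
  have nn: "0 \<le> fact (Suc m) * \<tau> ^ Suc m" using assms(2) by simp
  show ?case
  proof (cases "Kp (Suc m) x y = 0")
    case False
    then have w: "weight n x = weight n y + Suc m" using Kp_support[OF Suc.prems y] by blast
    let ?Z = "{z \<in> ternary_cube n. covers n x z \<and> (\<forall>j. y j \<le> z j)}"
    have "Kp (Suc m) x y = (\<Sum>z\<in>ternary_cube n. K x z * Kp m z y)" by simp
    also have "\<dots> = (\<Sum>z\<in>?Z. K x z * Kp m z y)"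
    proof (rule sum.mono_neutral_right)
      show "\<forall>z\<in>ternary_cube n - ?Z. K x z * Kp m z y = 0"
        using K_covers[OF Suc.prems] Kp_support[OF _ y, of _ m] by fastforce
    qed auto
    also have "\<dots> \<le> (\<Sum>z\<in>?Z. \<tau> * (fact m * \<tau> ^ m))"
      using w assms(2) Suc Kp_nonneg by (intro sum_mono mult_mono \<tau>) auto
    also have "\<dots> = real (card ?Z) * (\<tau> * (fact m * \<tau> ^ m))" by simp
    also have "\<dots> \<le> real (Suc m) * (\<tau> * (fact m * \<tau> ^ m))"
      using card_between_le[OF y, of x] w assms(2) by (intro mult_right_mono) auto
    finally show ?thesis by (simp add: algebra_simps)
  qed (use nn in simp)
qed simp

text \<open>By \<open>outer\<close>, a lower element exactly k layers below has rank at least n - k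
  / 2, so every step on the way starts at rank at least n - k + 1. For larger distances only the
  last k + 1 steps are used; by \<open>half\<close> they start at rank at least n / 2, hence have
  probability at most 4 / n each.\<close>

lemma Kp_pair_bound:
  assumes x: "x \<in> ternary_cube n" and y: "y \<in> ternary_cube n"
    and k: "weight n y + k \<le> weight n x" and outer: "2 * n \<le> weight n x + weight n y"
    and half: "n \<le> 2 * weight n y + 1" and "k \<le> n" "1 \<le> k"
    and B1: "fact k * (2 / real (n - k + 1)) ^ k \<le> B"
    and B2: "fact (Suc k) * (4 / real n) ^ Suc k \<le> B"
  shows "Kp (weight n x - weight n y) x y \<le> B"
proof (cases "weight n x = weight n y + k")
  case True
  have "Kp k x y \<le> fact k * (2 / real (n - k + 1)) ^ k"
  proof (rule Kp_le_fact[OF y _ _ x])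
    fix v z assume v: "v \<in> ternary_cube n" "z \<in> ternary_cube n" "weight n y < weight n v"
    have "2 / real (min (weight n v) n) \<le> 2 / real (n - k + 1)"
      using v(3) True outer assms(6,7) by (intro divide_left_mono mult_pos_pos) auto
    then show "K v z \<le> 2 / real (n - k + 1)" using K_le[OF v(1,2)] by linarith
  qed simp
  then show ?thesis using B1 True by simp
next
  case False
  define e where "e = weight n x - weight n y - Suc k"
  have e: "weight n x - weight n y = e + Suc k" using False k unfolding e_def by simp
  have "Kp (e + Suc k) x y \<le> fact (Suc k) * (4 / real n) ^ Suc k"
  proof (rule Kp_add_le[OF x])
    fix u assume u: "u \<in> ternary_cube n"
    show "Kp (Suc k) u y \<le> fact (Suc k) * (4 / real n) ^ Suc k"
    proof (rule Kp_le_fact[OF y _ _ u])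
      fix v z assume v: "v \<in> ternary_cube n" "z \<in> ternary_cube n" "weight n y < weight n v"
      have "2 / real (min (weight n v) n) \<le> 2 / (real n / 2)"
        using v(3) half assms(6,7) by (intro divide_left_mono mult_pos_pos) auto
      then show "K v z \<le> 4 / real n" using K_le[OF v(1,2)] by simp
    qed simp
  qed simp
  then show ?thesis unfolding e using B2 by linarith
qed

end

section \<open>Time reversal of the chain\<close>

definition inv_level :: "nat \<Rightarrow> (nat \<Rightarrow> nat) \<Rightarrow> real" where
  "inv_level n x = 1 / real (ell (weight n x) n)"

text \<open>The reversed chain, transported by complementation so that it descends as well.\<close>

definition up_step :: "nat \<Rightarrow> (nat \<Rightarrow> nat) \<Rightarrow> (nat \<Rightarrow> nat) \<Rightarrow> real" where
  "up_step n x y = down_step n (complement n y) (complement n x) / layer_ratio n (2 * n - weight n x)"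

lemma covers_complement:
  assumes "x \<in> ternary_cube n" "y \<in> ternary_cube n" "covers n (complement n y) (complement n x)"
  shows "covers n x y"
proof -
  obtain j where j: "j < n" "0 < complement n y j"
    "complement n x = (complement n y)(j := complement n y j - 1)"
    using assms(3) by (auto simp: covers_def)
  have le: "x i \<le> 2" "y i \<le> 2" for i
    using cube_value[OF assms(1), of i] cube_value[OF assms(2), of i] by auto
  have "y = x(j := x j - 1)" "0 < x j"
  proof -
    have xj: "complement n x j = complement n y j - 1" using j(3) by simp
    then show "0 < x j" using j(1,2) le[of j] by (simp add: complement_def)
    show "y = x(j := x j - 1)"
    proof
      fix i
      show "y i = (x(j := x j - 1)) i"
      proof (cases "i = j")
        case True
        then show ?thesis using xj j(1,2) le[of j] by (simp add: complement_def)
      next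
        case False
        have "complement n x i = complement n y i" using False j(3) by simp
        show ?thesis
        proof (cases "i < n")
          case True
          then show ?thesis
            using \<open>complement n x i = complement n y i\<close> False le[of i] by (simp add: complement_def)
        next
          case False
          then show ?thesis using assms(1,2) \<open>i \<noteq> j\<close> by (simp add: ternary_cube_def)
        qed
      qed
    qed
  qed
  then show ?thesis using j(1) by (auto simp: covers_def)
qed

lemma down_kernel_down_step: "down_kernel n (down_step n)"
proof
  fix x y assume x: "x \<in> ternary_cube n"
  show "0 \<le> down_step n x y" by (rule down_step_nonneg[OF x])
next
  fix x assume x: "x \<in> ternary_cube n"
  show "(\<Sum>y\<in>ternary_cube n. down_step n x y) \<le> 1"
  proof (cases "weight n x")
    case 0
    then have "down_step n x y = 0" for y
      using covers_weight[of n x y] down_step_zero[of n x y] by auto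
    then show ?thesis by simp
  qed (simp add: sum_down_step_row[OF x])
qed (auto intro: down_step_zero down_step_le)

lemma down_kernel_up_step: "down_kernel n (up_step n)"
proof
  fix x y assume "x \<in> ternary_cube n"
  have "0 \<le> layer_ratio n (2 * n - weight n x)" by (simp add: layer_ratio_def)
  then show "0 \<le> up_step n x y"
    unfolding up_step_def by (intro divide_nonneg_nonneg down_step_nonneg) auto
next
  fix x assume x: "x \<in> ternary_cube n"
  show "(\<Sum>y\<in>ternary_cube n. up_step n x y) \<le> 1"
  proof (cases "weight n x")
    case 0
    have w: "weight n (complement n x) = 2 * n" using weight_complement[OF x] 0 by simp
    have "\<not> covers n (complement n y) (complement n x)" for y
      using covers_weight[of n "complement n y" "complement n x"] weight_le[of "complement n y" n] w by auto
    then have "up_step n x y = 0" for y by (simp add: up_step_def down_step_zero)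
    then show ?thesis by simp
  next
    case (Suc r)
    have w: "weight n (complement n x) = 2 * n - weight n x" "2 * n - weight n x < 2 * n"
      using weight_complement[OF x] weight_le[OF x] Suc by auto
    have "(\<Sum>y\<in>ternary_cube n. down_step n (complement n y) (complement n x))
        = (\<Sum>z\<in>ternary_cube n. down_step n z (complement n x))"
      by (rule sum.reindex_bij_betw[OF bij_complement])
    also have "\<dots> = layer_ratio n (2 * n - weight n x)"
      using w by (intro sum_down_step_column) auto
    finally show ?thesis
      using layer_ratio_pos[OF w(2)] unfolding up_step_def sum_divide_distrib[symmetric] by simp
  qed
next
  fix x y assume xy: "x \<in> ternary_cube n" "y \<in> ternary_cube n" "\<not> covers n x y"
  then have "\<not> covers n (complement n y) (complement n x)" using covers_complement by blast
  then show "up_step n x y = 0" by (simp add: up_step_def down_step_zero)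
next
  fix x y assume xy: "x \<in> ternary_cube n" "y \<in> ternary_cube n"
  show "up_step n x y \<le> 2 / real (min (weight n x) n)"
  proof (cases "covers n (complement n y) (complement n x)")
    case True
    let ?s = "2 * n - weight n x"
    have cx: "weight n (complement n x) = ?s" using weight_complement[OF xy(1)] by simp
    then have w: "weight n (complement n y) = Suc ?s" using covers_weight[OF True] by simp
    have s: "?s < 2 * n" using weight_le[OF complement_cube[of n y]] w by simp
    have "2 * n - ?s = weight n x" using weight_le[OF xy(1)] by simp
    then have "down_step n (complement n y) (complement n x)
        \<le> layer_ratio n ?s * (2 / real (min (weight n x) n))"
      using down_step_le_reverse[OF complement_cube w] by metis
    then show ?thesis
      unfolding up_step_def using layer_ratio_pos[OF s] by (simp only: pos_divide_le_eq mult.commute)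
  qed (simp add: up_step_def down_step_zero)
qed simp

interpretation down: down_kernel n "down_step n" for n by (rule down_kernel_down_step)
interpretation up: down_kernel n "up_step n" for n by (rule down_kernel_up_step)

abbreviation "down_power n \<equiv> kernel_power (ternary_cube n) (down_step n)"
abbreviation "up_power n \<equiv> kernel_power (ternary_cube n) (up_step n)"

text \<open>Both sides are the probability that the uniform chain uses the edge from
  \<open>x\<close> to \<open>z\<close>, conditioned from the upper and from the lower end.
  Complementation turns the upward step into a descending one.\<close>

lemma reverse_step:
  assumes "x \<in> ternary_cube n" "z \<in> ternary_cube n"
  shows "inv_level n x * down_step n x z = inv_level n z * up_step n (complement n z) (complement n x)"
proof (cases "covers n x z")
  case True
  have w: "weight n x = Suc (weight n z)" "2 * n - weight n (complement n z) = weight n z"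
    using covers_weight[OF True] weight_complement[OF assms(2)] by auto
  have "0 < ell (weight n z) n" "0 < ell (Suc (weight n z)) n"
    using weight_le[OF assms(1)] w(1) by (auto intro: ell_pos)
  then show ?thesis
    using assms w by (simp add: up_step_def inv_level_def layer_ratio_def)
next
  case False
  then show ?thesis using assms by (simp add: up_step_def down_step_zero)
qed

lemma reverse_power:
  assumes "x \<in> ternary_cube n" "y \<in> ternary_cube n"
  shows "inv_level n x * down_power n d x y = inv_level n y * up_power n d (complement n y) (complement n x)"
  using assms(1)
proof (induction d arbitrary: x)
  case 0
  have "x = y \<longleftrightarrow> complement n y = complement n x"
    using 0 assms(2) by (metis complement_complement)
  then show ?case by (cases "x = y") simp_all
next
  case (Suc d)
  let ?V = "ternary_cube n" and ?c = "complement n"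
  have "inv_level n x * down_power n (Suc d) x y
      = (\<Sum>z\<in>?V. (inv_level n x * down_step n x z) * down_power n d z y)"
    by (simp add: sum_distrib_left mult.assoc)
  also have "\<dots> = (\<Sum>z\<in>?V. up_step n (?c z) (?c x) * (inv_level n z * down_power n d z y))"
    using reverse_step[OF Suc.prems] by (intro sum.cong refl) (simp add: ac_simps)
  also have "\<dots> = (\<Sum>z\<in>?V. inv_level n y * (up_power n d (?c y) (?c z) * up_step n (?c z) (?c x)))"
    using Suc.IH by (intro sum.cong refl) (simp add: ac_simps)
  also have "\<dots> = inv_level n y * (\<Sum>z\<in>?V. up_power n d (?c y) (?c z) * up_step n (?c z) (?c x))"
    by (rule sum_distrib_left[symmetric])
  also have "(\<Sum>z\<in>?V. up_power n d (?c y) (?c z) * up_step n (?c z) (?c x))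
      = (\<Sum>z\<in>?V. up_power n d (?c y) z * up_step n z (?c x))"
    by (rule sum.reindex_bij_betw[OF bij_complement])
  also have "\<dots> = up_power n (Suc d) (?c y) (?c x)"
    by (rule up.Kp_Suc_right[symmetric]) simp_all
  finally show ?case .
qed

section \<open>LYM inequalities with a correction for pairs\<close>

definition level_mass :: "nat \<Rightarrow> nat \<Rightarrow> (nat \<Rightarrow> nat) \<Rightarrow> real" where
  "level_mass n t x = (if weight n x + t = 2 * n then inv_level n x else 0)"

lemma sum_inv_level:
  assumes "r \<le> 2 * n" shows "(\<Sum>x\<in>layer n r. inv_level n x) = 1"
proof -
  have "(\<Sum>x\<in>layer n r. inv_level n x) = (\<Sum>x\<in>layer n r. 1 / real (ell r n))"
    by (rule sum.cong) (auto simp: inv_level_def layer_def)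
  also have "\<dots> = 1" using ell_pos[OF assms] unfolding ell_eq sum_constant by (simp add: card_gt_0_iff)
  finally show ?thesis .
qed

lemma level_mass_0: "(\<Sum>x\<in>ternary_cube n. level_mass n 0 x) = 1"
proof -
  have "(\<Sum>x\<in>ternary_cube n. level_mass n 0 x) = (\<Sum>x\<in>layer n (2 * n). inv_level n x)"
    unfolding layer_def by (subst sum.inter_filter) (simp_all add: level_mass_def)
  then show ?thesis by (simp add: sum_inv_level)
qed

text \<open>The uniform law is carried from layer to layer because every column of the kernel
  between ranks s + 1 and s has the same sum, the quotient of the two layer sizes.\<close>

lemma level_mass_Suc:
  assumes y: "y \<in> ternary_cube n"
  shows "level_mass n (Suc t) y = (\<Sum>x\<in>ternary_cube n. level_mass n t x * down_step n x y)"
proof (cases "weight n y + Suc t = 2 * n")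
  case True
  let ?s = "weight n y"
  have s: "?s < 2 * n" using True by simp
  have "(\<Sum>x\<in>ternary_cube n. level_mass n t x * down_step n x y)
      = (\<Sum>x\<in>ternary_cube n. 1 / real (ell (Suc ?s) n) * down_step n x y)"
  proof (rule sum.cong[OF refl])
    fix x
    show "level_mass n t x * down_step n x y = 1 / real (ell (Suc ?s) n) * down_step n x y"
      using True covers_weight[of n x y] down_step_zero[of n x y]
      by (cases "covers n x y") (auto simp: level_mass_def inv_level_def)
  qed
  also have "\<dots> = 1 / real (ell (Suc ?s) n) * layer_ratio n ?s"
    unfolding sum_distrib_left[symmetric] sum_down_step_column[OF y refl s] ..
  also have "\<dots> = level_mass n (Suc t) y"
    using True s ell_pos[of "Suc ?s" n] by (simp add: level_mass_def inv_level_def layer_ratio_def)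
  finally show ?thesis ..
next
  case False
  have "level_mass n t x * down_step n x y = 0" for x
    using False covers_weight[of n x y] down_step_zero[of n x y]
    by (cases "covers n x y") (auto simp: level_mass_def)
  then have "(\<Sum>x\<in>ternary_cube n. level_mass n t x * down_step n x y) = 0" by (simp only: sum.neutral_const)
  then show ?thesis using False by (simp add: level_mass_def)
qed

lemma lym_pairs:
  assumes S: "S \<subseteq> ternary_cube n"
  shows "(\<Sum>x\<in>S. inv_level n x) \<le> 1 + (\<Sum>x\<in>S. \<Sum>y\<in>S. if weight n y < weight n x
      then inv_level n x * down_power n (weight n x - weight n y) x y else 0)"
proof -
  let ?m = "Suc (2 * n)"
  have q: "0 \<le> inv_level n x" for x by (simp add: inv_level_def)
  have nn: "0 \<le> level_mass n t x" for t x by (simp add: level_mass_def q)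
  have "(\<Sum>t<?m. \<Sum>y\<in>S. level_mass n t y)
      \<le> 1 + (\<Sum>t<?m. \<Sum>s<t. \<Sum>x\<in>S. \<Sum>y\<in>S. level_mass n s x * down_power n (t - s) x y)"
    by (rule down.visits_bound[where Q = "level_mass n", OF S nn])
      (simp_all add: level_mass_0 level_mass_Suc)
  moreover have "(\<Sum>t<?m. \<Sum>y\<in>S. level_mass n t y) = (\<Sum>y\<in>S. inv_level n y)"
  proof -
    have "(\<Sum>t<?m. level_mass n t y) = inv_level n y" if "y \<in> S" for y
    proof -
      have w: "weight n y \<le> 2 * n" using that S weight_le by blast
      have "(\<Sum>t<?m. level_mass n t y) = (\<Sum>t<?m. if t = 2 * n - weight n y then inv_level n y else 0)"
        by (rule sum.cong[OF refl]) (use w in \<open>auto simp: level_mass_def\<close>)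
      then show ?thesis by simp
    qed
    then show ?thesis by (subst sum.swap) simp
  qed
  moreover have "(\<Sum>t<?m. \<Sum>s<t. \<Sum>x\<in>S. \<Sum>y\<in>S. level_mass n s x * down_power n (t - s) x y)
      \<le> (\<Sum>x\<in>S. \<Sum>y\<in>S. if weight n y < weight n x
      then inv_level n x * down_power n (weight n x - weight n y) x y else 0)"
  proof -
    have "(\<Sum>t<?m. \<Sum>s<t. \<Sum>x\<in>S. \<Sum>y\<in>S. level_mass n s x * down_power n (t - s) x y)
        = (\<Sum>t<?m. \<Sum>x\<in>S. \<Sum>s<t. \<Sum>y\<in>S. level_mass n s x * down_power n (t - s) x y)"
      by (rule sum.cong[OF refl], rule sum.swap)
    also have "\<dots> = (\<Sum>x\<in>S. \<Sum>t<?m. \<Sum>s<t. \<Sum>y\<in>S. level_mass n s x * down_power n (t - s) x y)"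
      by (rule sum.swap)
    also have "\<dots> = (\<Sum>x\<in>S. \<Sum>t<?m. \<Sum>y\<in>S. \<Sum>s<t. level_mass n s x * down_power n (t - s) x y)"
      by (rule sum.cong[OF refl], rule sum.cong[OF refl], rule sum.swap)
    also have "\<dots> = (\<Sum>x\<in>S. \<Sum>y\<in>S. \<Sum>t<?m. \<Sum>s<t. level_mass n s x * down_power n (t - s) x y)"
      by (rule sum.cong[OF refl], rule sum.swap)
    also have "\<dots> \<le> (\<Sum>x\<in>S. \<Sum>y\<in>S. if weight n y < weight n x
      then inv_level n x * down_power n (weight n x - weight n y) x y else 0)"
    proof (intro sum_mono)
      fix x y assume xy: "x \<in> S" "y \<in> S"
      then have V: "x \<in> ternary_cube n" "y \<in> ternary_cube n" using S by auto
      define g where "g = (if weight n y < weight n x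
        then inv_level n x * down_power n (weight n x - weight n y) x y else 0)"
      have g: "0 \<le> g" using q down.Kp_nonneg[OF V(1)] by (simp add: g_def)
      have w: "weight n x \<le> 2 * n" using V(1) by (rule weight_le)
      \<comment> \<open>The rank falls by one per step, so both times are determined by the pair:
        only s = 2n - weight x and t = 2n - weight y contribute.\<close>
      have "(\<Sum>s<t. level_mass n s x * down_power n (t - s) x y)
          \<le> (if t = 2 * n - weight n y then g else 0)" (is "?l \<le> ?r") for t
      proof -
        have "?l \<le> (\<Sum>s<t. if s = 2 * n - weight n x then ?r else 0)"
        proof (rule sum_mono)
          fix s assume s: "s \<in> {..<t}"
          show "level_mass n s x * down_power n (t - s) x y \<le> (if s = 2 * n - weight n x then ?r else 0)"
          proof (cases "level_mass n s x * down_power n (t - s) x y = 0")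
            case True
            then show ?thesis unfolding True using g by simp
          next
            case False
            then have a: "weight n x + s = 2 * n" "level_mass n s x = inv_level n x"
              by (auto simp: level_mass_def split: if_splits)
            have "weight n x = weight n y + (t - s)" using down.Kp_support[OF V] False by auto
            then have "s = 2 * n - weight n x" "t = 2 * n - weight n y" "weight n y < weight n x"
              "t - s = weight n x - weight n y"
              using a(1) s by auto
            then show ?thesis using a(2) by (simp add: g_def)
          qed
        qed
        also have "\<dots> \<le> ?r" using g by simp
        finally show ?thesis .
      qed
      then have "(\<Sum>t<?m. \<Sum>s<t. level_mass n s x * down_power n (t - s) x y)
          \<le> (\<Sum>t<?m. if t = 2 * n - weight n y then g else 0)"
        by (rule sum_mono)
      also have "\<dots> = g" by (subst sum.delta) auto
      finally show "(\<Sum>t<?m. \<Sum>s<t. level_mass n s x * down_power n (t - s) x y)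
          \<le> (if weight n y < weight n x
            then inv_level n x * down_power n (weight n x - weight n y) x y else 0)"
        unfolding g_def .
    qed
    finally show ?thesis .
  qed
  ultimately show ?thesis by linarith
qed

text \<open>Two elements in different layers of the same residue class modulo \<open>k\<close> are at least \<open>k\<close> layers apart.\<close>

lemma lym_far_pairs:
  assumes S: "S \<subseteq> ternary_cube n" and k: "1 \<le> k"
  shows "(\<Sum>x\<in>S. inv_level n x) \<le> real k + (\<Sum>x\<in>S. \<Sum>y\<in>S. if weight n y + k \<le> weight n x
      then inv_level n x * down_power n (weight n x - weight n y) x y else 0)"
proof -
  let ?S = "\<lambda>c. {x \<in> S. weight n x mod k = c}"
  let ?p = "\<lambda>x y. inv_level n x * down_power n (weight n x - weight n y) x y"
  have fin: "finite S" using S by (rule finite_subset) simp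
  have p: "0 \<le> ?p x y" if "x \<in> S" for x y
    using down.Kp_nonneg that S by (auto simp: inv_level_def)
  have group: "(\<Sum>c<k. \<Sum>x\<in>?S c. f x) = (\<Sum>x\<in>S. f x)" for f :: "(nat \<Rightarrow> nat) \<Rightarrow> real"
    using fin k by (intro sum.group) auto
  have "(\<Sum>x\<in>?S c. inv_level n x) \<le> 1 + (\<Sum>x\<in>?S c. \<Sum>y\<in>S. if weight n y + k \<le> weight n x then ?p x y else 0)" for c
  proof -
    have "(\<Sum>x\<in>?S c. inv_level n x)
        \<le> 1 + (\<Sum>x\<in>?S c. \<Sum>y\<in>?S c. if weight n y < weight n x then ?p x y else 0)"
      using S by (intro lym_pairs) auto
    also have "(\<Sum>x\<in>?S c. \<Sum>y\<in>?S c. if weight n y < weight n x then ?p x y else 0)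
        \<le> (\<Sum>x\<in>?S c. \<Sum>y\<in>S. if weight n y + k \<le> weight n x then ?p x y else 0)"
    proof (rule sum_mono)
      fix x assume x: "x \<in> ?S c"
      have "weight n y + k \<le> weight n x" if y: "y \<in> ?S c" "weight n y < weight n x" for y
      proof -
        have "k dvd weight n x - weight n y"
          using x y by (subst mod_eq_dvd_iff_nat[symmetric]) auto
        then have "k \<le> weight n x - weight n y" using y(2) by (intro dvd_imp_le) auto
        then show ?thesis using y(2) by linarith
      qed
      then have "(\<Sum>y\<in>?S c. if weight n y < weight n x then ?p x y else 0)
          \<le> (\<Sum>y\<in>?S c. if weight n y + k \<le> weight n x then ?p x y else 0)"
        using p x k by (intro sum_mono) auto
      also have "\<dots> \<le> (\<Sum>y\<in>S. if weight n y + k \<le> weight n x then ?p x y else 0)"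
        using p x fin k by (intro sum_mono2) auto
      finally show "(\<Sum>y\<in>?S c. if weight n y < weight n x then ?p x y else 0)
          \<le> (\<Sum>y\<in>S. if weight n y + k \<le> weight n x then ?p x y else 0)" .
    qed
    finally show ?thesis by simp
  qed
  then have "(\<Sum>c<k. \<Sum>x\<in>?S c. inv_level n x)
      \<le> (\<Sum>c<k. 1 + (\<Sum>x\<in>?S c. \<Sum>y\<in>S. if weight n y + k \<le> weight n x then ?p x y else 0))"
    by (rule sum_mono)
  then show ?thesis unfolding sum.distrib group by simp
qed

section \<open>Supersaturation\<close>

definition neighbours :: "nat \<Rightarrow> (nat \<Rightarrow> nat) set \<Rightarrow> (nat \<Rightarrow> nat) \<Rightarrow> (nat \<Rightarrow> nat) set" where
  "neighbours n S x = {y \<in> S. x \<noteq> y \<and> (cube_le n x y \<or> cube_le n y x)}"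

text \<open>The neighbours \<open>y\<close> of \<open>x\<close> that are at most as far from the middle layer as \<open>x\<close>; ties go to the
  upper element, so that each comparable pair is charged to exactly one of its elements.\<close>

definition inner_neighbours :: "nat \<Rightarrow> (nat \<Rightarrow> nat) set \<Rightarrow> (nat \<Rightarrow> nat) \<Rightarrow> (nat \<Rightarrow> nat) set" where
  "inner_neighbours n S x = {y \<in> S. x \<noteq> y \<and> (cube_le n y x \<and> 2 * n \<le> weight n x + weight n y
     \<or> cube_le n x y \<and> weight n x + weight n y < 2 * n)}"

lemma cube_le_antisym:
  assumes "x \<in> ternary_cube n" "y \<in> ternary_cube n" "cube_le n x y" "cube_le n y x"
  shows "x = y"
proof
  fix j show "x j = y j"
    using assms by (cases "j < n") (auto simp: ternary_cube_def cube_le_def intro: antisym)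
qed

lemma finite_pairs: "finite S \<Longrightarrow> finite {{x, y} | x y. x \<in> S \<and> y \<in> S \<and> x \<noteq> y \<and> cube_le n x y}"
  by (rule finite_subset[of _ "Pow S"]) auto

lemma pair_mem:
  assumes "x \<in> S" "y \<in> S" "x \<noteq> y" "cube_le n x y \<or> cube_le n y x"
  shows "{x, y} \<in> {{x, y} | x y. x \<in> S \<and> y \<in> S \<and> x \<noteq> y \<and> cube_le n x y}"
proof (cases "cube_le n x y")
  case True
  then show ?thesis using assms by blast
next
  case False
  then have "{y, x} \<in> {{x, y} | x y. x \<in> S \<and> y \<in> S \<and> x \<noteq> y \<and> cube_le n x y}"
    using assms by blast
  moreover have "{x, y} = {y, x}" by auto
  ultimately show ?thesis by (simp only:)
qed

lemma sum_inner_neighbours_le: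
  assumes S: "S \<subseteq> ternary_cube n"
  shows "(\<Sum>x\<in>S. card (inner_neighbours n S x)) \<le> comp n S"
proof -
  have fin: "finite S" using S by (rule finite_subset) simp
  let ?I = "Sigma S (inner_neighbours n S)"
  have "(\<Sum>x\<in>S. card (inner_neighbours n S x)) = card ?I"
    using fin by (subst card_SigmaI) (auto simp: inner_neighbours_def)
  also have "\<dots> = card ((\<lambda>(x, y). {x, y}) ` ?I)"
  proof (rule card_image[symmetric], rule inj_onI, clarify)
    fix x y x' y' assume a: "x \<in> S" "y \<in> inner_neighbours n S x" "x' \<in> S"
      "y' \<in> inner_neighbours n S x'" "{x, y} = {x', y'}"
    have "\<not> (x' = y \<and> y' = x \<and> x \<noteq> y)"
    proof
      assume "x' = y \<and> y' = x \<and> x \<noteq> y"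
      then have "cube_le n x y" "cube_le n y x"
        using a(2,4) by (auto simp: inner_neighbours_def add.commute)
      then show False
        using cube_le_antisym[of x n y] a(1,3) S \<open>x' = y \<and> y' = x \<and> x \<noteq> y\<close> by auto
    qed
    then show "x = x' \<and> y = y'" using a(5) by (auto simp: doubleton_eq_iff)
  qed
  also have "\<dots> \<le> comp n S"
    unfolding comp_def
  proof (rule card_mono[OF finite_pairs[OF fin]], rule image_subsetI)
    fix p assume "p \<in> ?I"
    then obtain x y where "p = (x, y)" "x \<in> S" "y \<in> inner_neighbours n S x" by auto
    then show "(case p of (x, y) \<Rightarrow> {x, y}) \<in> {{x, y} | x y. x \<in> S \<and> y \<in> S \<and> x \<noteq> y \<and> cube_le n x y}"
      unfolding prod.case by (simp only: prod.case) (rule pair_mem, auto simp: inner_neighbours_def)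
  qed
  finally show ?thesis .
qed

lemma comp_remove:
  assumes S: "finite S" "x \<in> S"
  shows "comp n (S - {x}) + card (neighbours n S x) \<le> comp n S"
proof -
  let ?P = "\<lambda>S. {{x, y} | x y. x \<in> S \<and> y \<in> S \<and> x \<noteq> y \<and> cube_le n x y}"
  have "card ((\<lambda>y. {x, y}) ` neighbours n S x) = card (neighbours n S x)"
    by (rule card_image) (auto simp: inj_on_def neighbours_def doubleton_eq_iff)
  moreover have "card (?P (S - {x})) + card ((\<lambda>y. {x, y}) ` neighbours n S x)
      = card (?P (S - {x}) \<union> (\<lambda>y. {x, y}) ` neighbours n S x)"
  proof (rule card_Un_disjoint[symmetric])
    show "finite (?P (S - {x}))" using S(1) by (intro finite_pairs) auto
    show "finite ((\<lambda>y. {x, y}) ` neighbours n S x)" using S(1) by (auto simp: neighbours_def)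
    show "?P (S - {x}) \<inter> (\<lambda>y. {x, y}) ` neighbours n S x = {}" by (auto simp: doubleton_eq_iff)
  qed
  moreover have "card (?P (S - {x}) \<union> (\<lambda>y. {x, y}) ` neighbours n S x) \<le> card (?P S)"
  proof (rule card_mono[OF finite_pairs[OF S(1)]])
    have "{x, y} \<in> ?P S" if "y \<in> neighbours n S x" for y
      using that S(2) by (intro pair_mem) (auto simp: neighbours_def)
    then show "?P (S - {x}) \<union> (\<lambda>y. {x, y}) ` neighbours n S x \<subseteq> ?P S" by blast
  qed
  ultimately show ?thesis unfolding comp_def by linarith
qed

text \<open>The left side is the probability that the uniform chain visits both elements. It is
  conditioned on the element that is charged: on \<open>x\<close> with the descending chain, or on
  \<open>y\<close> with the reversed chain through \<open>reverse_power\<close>.\<close>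

lemma far_pair_bound:
  assumes V: "x \<in> ternary_cube n" "y \<in> ternary_cube n"
    and far: "weight n y + k \<le> weight n x" and k: "1 \<le> k" "k \<le> n"
    and upper: "2 * n \<le> weight n x + weight n y \<Longrightarrow> n \<le> 2 * weight n y + 1"
    and lower: "weight n x + weight n y < 2 * n \<Longrightarrow> n \<le> 2 * (2 * n - weight n x) + 1"
    and B1: "fact k * (2 / real (n - k + 1)) ^ k \<le> B"
    and B2: "fact (Suc k) * (4 / real n) ^ Suc k \<le> B"
  shows "inv_level n x * down_power n (weight n x - weight n y) x y
    \<le> (if x \<noteq> y \<and> cube_le n y x \<and> 2 * n \<le> weight n x + weight n y then inv_level n x * B else 0)
      + (if x \<noteq> y \<and> cube_le n y x \<and> weight n x + weight n y < 2 * n then inv_level n y * B else 0)"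
    (is "?l \<le> ?r")
proof (cases "down_power n (weight n x - weight n y) x y = 0")
  case True
  have "0 \<le> fact k * (2 / real (n - k + 1)) ^ k" by simp
  then have "0 \<le> B" using B1 by linarith
  then show ?thesis unfolding True by (simp add: inv_level_def)
next
  case False
  then have le: "cube_le n y x" "x \<noteq> y"
    using down.Kp_support[OF V False] far k by (auto simp: cube_le_def)
  show ?thesis
  proof (cases "2 * n \<le> weight n x + weight n y")
    case True
    have "down_power n (weight n x - weight n y) x y \<le> B"
      using V far True upper[OF True] k B1 B2 by (intro down.Kp_pair_bound) auto
    then have "?l \<le> inv_level n x * B" by (intro mult_left_mono) (auto simp: inv_level_def)
    then show ?thesis using True le by simp
  next
    case False
    let ?x = "complement n x" and ?y = "complement n y"
    have w: "weight n ?x + weight n x = 2 * n" "weight n ?y + weight n y = 2 * n"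
      using V weight_complement by auto
    have "up_power n (weight n ?y - weight n ?x) ?y ?x \<le> B"
    proof (rule up.Kp_pair_bound[where k = k])
      show "weight n ?x + k \<le> weight n ?y" "2 * n \<le> weight n ?y + weight n ?x"
        using w far False by linarith+
      show "n \<le> 2 * weight n ?x + 1" using lower False w(1) by auto
    qed (use k B1 B2 in auto)
    moreover have "weight n ?y - weight n ?x = weight n x - weight n y" using w by linarith
    ultimately have "inv_level n y * up_power n (weight n x - weight n y) ?y ?x \<le> inv_level n y * B"
      by (intro mult_left_mono) (auto simp: inv_level_def)
    then have "?l \<le> inv_level n y * B" unfolding reverse_power[OF V] .
    then show ?thesis using False le by simp
  qed
qed

text \<open>\<open>upper\<close> and \<open>lower\<close> ensure that the inner element of a charged
  pair is not too far on the other side of the middle, as the pair bound requires for the descending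
  and the reversed chain.\<close>

lemma zone_inequality:
  assumes S: "S \<subseteq> ternary_cube n" and A: "A \<subseteq> S" and k: "1 \<le> k" "k \<le> n"
    and upper: "\<And>x y. x \<in> A \<Longrightarrow> y \<in> A \<Longrightarrow> weight n y \<le> weight n x \<Longrightarrow>
      2 * n \<le> weight n x + weight n y \<Longrightarrow> n \<le> 2 * weight n y + 1"
    and lower: "\<And>x y. x \<in> A \<Longrightarrow> y \<in> A \<Longrightarrow> weight n y \<le> weight n x \<Longrightarrow>
      weight n x + weight n y < 2 * n \<Longrightarrow> n \<le> 2 * (2 * n - weight n x) + 1"
    and B1: "fact k * (2 / real (n - k + 1)) ^ k \<le> B"
    and B2: "fact (Suc k) * (4 / real n) ^ Suc k \<le> B"
  shows "(\<Sum>x\<in>A. inv_level n x * (1 - B * card (inner_neighbours n S x))) \<le> real k"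
proof -
  have finS: "finite S" by (rule finite_subset[OF S]) simp
  have fin: "finite S" "finite A" using finS finite_subset[OF A] by auto
  have "0 \<le> fact k * (2 / real (n - k + 1)) ^ k" by simp
  then have B: "0 \<le> B" using B1 by linarith
  have q: "0 \<le> inv_level n x" for x by (simp add: inv_level_def)
  let ?a = "\<lambda>x y. if x \<noteq> y \<and> cube_le n y x \<and> 2 * n \<le> weight n x + weight n y then inv_level n x * B else 0"
  let ?b = "\<lambda>x y. if x \<noteq> y \<and> cube_le n y x \<and> weight n x + weight n y < 2 * n then inv_level n y * B else 0"
  have "(\<Sum>x\<in>A. inv_level n x) \<le> real k + (\<Sum>x\<in>A. \<Sum>y\<in>A. if weight n y + k \<le> weight n x
      then inv_level n x * down_power n (weight n x - weight n y) x y else 0)"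
    using S A k by (intro lym_far_pairs) auto
  also have "(\<Sum>x\<in>A. \<Sum>y\<in>A. if weight n y + k \<le> weight n x
      then inv_level n x * down_power n (weight n x - weight n y) x y else 0)
      \<le> (\<Sum>x\<in>A. \<Sum>y\<in>A. ?a x y + ?b x y)"
  proof (intro sum_mono)
    fix x y assume xy: "x \<in> A" "y \<in> A"
    then have V: "x \<in> ternary_cube n" "y \<in> ternary_cube n" using A S by auto
    show "(if weight n y + k \<le> weight n x
        then inv_level n x * down_power n (weight n x - weight n y) x y else 0) \<le> ?a x y + ?b x y"
    proof (cases "weight n y + k \<le> weight n x")
      case True
      then have "weight n y \<le> weight n x" by simp
      then show ?thesis
        using far_pair_bound[OF V True k upper[OF xy] lower[OF xy] B1 B2] True by simp
    next
      case False
      then show ?thesis using B q by simp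
    qed
  qed
  \<comment> \<open>Renaming the variables in the second part lets \<open>x\<close> be the charged
    element in both.\<close>
  also have "\<dots> = (\<Sum>x\<in>A. \<Sum>y\<in>A. ?a x y) + (\<Sum>x\<in>A. \<Sum>y\<in>A. ?b y x)"
    unfolding sum.distrib by (rule arg_cong2[where f = "(+)", OF refl]) (rule sum.swap)
  also have "\<dots> = (\<Sum>x\<in>A. \<Sum>y\<in>A. ?a x y + ?b y x)"
    unfolding sum.distrib ..
  also have "\<dots> \<le> (\<Sum>x\<in>A. inv_level n x * (B * card (inner_neighbours n S x)))"
  proof (rule sum_mono)
    fix x assume x: "x \<in> A"
    have "(\<Sum>y\<in>A. ?a x y + ?b y x) \<le> (\<Sum>y\<in>A. if y \<in> inner_neighbours n S x then inv_level n x * B else 0)"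
      using A B q by (intro sum_mono) (auto simp: inner_neighbours_def add.commute)
    also have "\<dots> \<le> (\<Sum>y\<in>S. if y \<in> inner_neighbours n S x then inv_level n x * B else 0)"
      using A B q fin by (intro sum_mono2) auto
    also have "\<dots> = (\<Sum>y\<in>{y \<in> S. y \<in> inner_neighbours n S x}. inv_level n x * B)"
      using fin by (intro sum.inter_filter[symmetric])
    also have "{y \<in> S. y \<in> inner_neighbours n S x} = inner_neighbours n S x"
      by (auto simp: inner_neighbours_def)
    finally show "(\<Sum>y\<in>A. ?a x y + ?b y x) \<le> inv_level n x * (B * card (inner_neighbours n S x))"
      by (simp add: ac_simps)
  qed
  finally show ?thesis by (simp add: right_diff_distrib sum_subtractf)
qed

lemma ell_doubles:
  assumes "2 * Suc i \<le> n" shows "2 * ell i n \<le> ell (Suc i) n"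
proof -
  have "n * (2 * ell i n) \<le> 2 * Suc i * ell (Suc i) n"
    using ell_ratio_lower_half[of i n] assms by simp
  also have "\<dots> \<le> n * ell (Suc i) n" using assms by (rule mult_le_mono1)
  finally show ?thesis using assms by simp
qed

lemma ell_outer_le:
  assumes "2 * Suc i \<le> n" "2 * d \<le> n" shows "2 * ell i n \<le> ell (n + d) n"
proof -
  have "Suc i + d \<le> n" using assms by arith
  then show ?thesis
    using ell_doubles[OF assms(1)] ell_le_central[of d n "Suc i"] assms by simp
qed

text \<open>The pair bound fails for a very low and a very high element. We average the inequality for \<open>S\<close>
  without its low part with that for \<open>S\<close> without its high part. Elements of these parts are then
  counted with half their weight, which suffices because their layers are at most half as large as
  the smallest of the \<open>k\<close> middle layers.\<close>

lemma bounded_degree_inequality: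
  assumes S: "S \<subseteq> ternary_cube n" and k: "1 \<le> k" "k \<le> n" and B: "0 < B"
    and deg: "\<And>x. x \<in> S \<Longrightarrow> B * real (card (inner_neighbours n S x)) \<le> 1"
    and B1: "fact k * (2 / real (n - k + 1)) ^ k \<le> B"
    and B2: "fact (Suc k) * (4 / real n) ^ Suc k \<le> B"
  shows "real (card S) \<le> real (\<Sum>r = n - (k - 1) div 2 .. n + k div 2. ell r n) + B * real (comp n S)"
proof -
  have fin: "finite S" using S by (rule finite_subset) simp
  \<comment> \<open>The size of the smallest middle layer, which is the threshold of the knapsack
    problem.\<close>
  define L where "L = real (ell (n + k div 2) n)"
  have L: "0 < L" unfolding L_def using k by (simp add: ell_pos)
  define v where "v x = 1 - B * real (card (inner_neighbours n S x))" for x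
  have v: "0 \<le> v x" "v x \<le> 1" if "x \<in> S" for x
    using deg[OF that] B by (auto simp: v_def)
  define U where "U = {x \<in> S. n \<le> 2 * weight n x + 1}"
  define D where "D = {x \<in> S. n \<le> 2 * (2 * n - weight n x) + 1}"
  \<comment> \<open>\<open>k div 2\<close> is the ceiling of (k - 1) / 2, so these are k
    ranks.\<close>
  define R where "R = {n - (k - 1) div 2 .. n + k div 2}"
  define M where "M = {x \<in> ternary_cube n. weight n x \<in> R}"
  have kd: "(k - 1) div 2 \<le> k div 2" "k div 2 \<le> n" "k div 2 \<le> Suc ((k - 1) div 2)" "2 * (k div 2) \<le> n"
    using k by auto
  have R_mem: "n \<le> r + k div 2" "r \<le> n + k div 2" if "r \<in> R" for r
  proof -
    have "n \<le> r + (k - 1) div 2" using that unfolding R_def by (simp only: atLeastAtMost_iff le_diff_conv)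
    then show "n \<le> r + k div 2" using kd(1) by (rule order_trans[OF _ add_left_mono])
    show "r \<le> n + k div 2" using that unfolding R_def by simp
  qed
  have R_out: "r + k div 2 \<le> n \<or> n + k div 2 \<le> r" if "r \<notin> R" for r
  proof (cases "n + k div 2 < r")
    case False
    then have "r < n - (k - 1) div 2" using that by (simp add: R_def)
    then have "Suc (r + (k - 1) div 2) \<le> n" by (simp only: less_diff_conv Suc_le_eq)
    moreover have "r + k div 2 \<le> r + Suc ((k - 1) div 2)" using kd(3) by (rule add_left_mono)
    ultimately show ?thesis by simp
  qed simp
  \<comment> \<open>A pair that violates a rank condition of \<open>zone_inequality\<close> has one
    very low and one very high element. Hence it is enough to leave out one of the two
    kinds.\<close>
  have zone_U: "(\<Sum>x\<in>U. inv_level n x * v x) \<le> real k"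
    unfolding v_def by (rule zone_inequality[OF S _ k _ _ B1 B2]) (auto simp: U_def)
  have zone_D: "(\<Sum>x\<in>D. inv_level n x * v x) \<le> real k"
    unfolding v_def by (rule zone_inequality[OF S _ k _ _ B1 B2]) (auto simp: D_def)
  \<comment> \<open>Dual certificate for the knapsack problem with values \<open>v x\<close>, cost
    \<open>inv_level n x\<close> per unit and critical cost 1 / L. Outside \<open>M\<close> the cost
    is at least 1 / L; inside, the last term makes up for the cheaper elements. An element in only
    one of \<open>U\<close> and \<open>D\<close> pays half its cost, which is still at least 1 / L
    per unit.\<close>
  have pointwise: "v x / L \<le> ((if x \<in> U then inv_level n x * v x else 0)
      + (if x \<in> D then inv_level n x * v x else 0)) / 2
      + (if x \<in> M then 1 / L - inv_level n x else 0)" if x: "x \<in> S" for x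
  proof -
    have xV: "x \<in> ternary_cube n" using x S by auto
    have w: "weight n x \<le> 2 * n" using xV by (rule weight_le)
    have pos: "0 < real (ell (weight n x) n)" using ell_pos[OF w] by simp
    have scale: "v x / L \<le> inv_level n x * v x" if "inv_level n x \<ge> 1 / L"
      using mult_right_mono[OF that v(1)[OF x]] by simp
    have outer: "v x / L \<le> inv_level n x * v x / 2" "x \<notin> M"
      if "2 * ell (weight n x) n \<le> ell (n + k div 2) n"
    proof -
      have "2 * real (ell (weight n x) n) \<le> L"
        unfolding L_def using that by (metis of_nat_le_iff of_nat_mult of_nat_numeral)
      then have "1 / L \<le> inv_level n x / 2"
        using pos L by (simp add: inv_level_def field_simps)
      from mult_right_mono[OF this v(1)[OF x]] show "v x / L \<le> inv_level n x * v x / 2" by simp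
      show "x \<notin> M"
      proof
        assume "x \<in> M"
        then have "ell (n + k div 2) n \<le> ell (weight n x) n"
          using kd(2) R_mem by (intro ell_ge_central) (auto simp: M_def)
        then show False using that pos by simp
      qed
    qed
    consider "x \<notin> U" | "x \<notin> D" | "x \<in> U" "x \<in> D" "x \<in> M" | "x \<in> U" "x \<in> D" "x \<notin> M" by blast
    then show ?thesis
    proof cases
      case 1
      then have a: "2 * Suc (weight n x) \<le> n" using x by (simp add: U_def)
      then have "x \<in> D" using x by (simp add: D_def)
      then show ?thesis using 1 outer[OF ell_outer_le[OF a kd(4)]] by simp
    next
      case 2
      then have a: "2 * Suc (2 * n - weight n x) \<le> n" using x by (simp add: D_def)
      then have "x \<in> U" using x w by (simp add: U_def)
      moreover have "2 * ell (weight n x) n \<le> ell (n + k div 2) n"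
        using ell_outer_le[OF a kd(4)] ell_symmetric[OF w] by simp
      ultimately show ?thesis using 2 outer by simp
    next
      case 3
      have "L \<le> real (ell (weight n x) n)"
        unfolding L_def using 3(3) kd(2) R_mem by (intro of_nat_mono ell_ge_central) (auto simp: M_def)
      then have "inv_level n x \<le> 1 / L"
        unfolding inv_level_def using L by (intro divide_left_mono mult_pos_pos) auto
      then have "v x * (1 / L - inv_level n x) \<le> 1 * (1 / L - inv_level n x)"
        using v(2)[OF x] by (intro mult_right_mono) auto
      then show ?thesis using 3 by (simp add: algebra_simps)
    next
      case 4
      have "real (ell (weight n x) n) \<le> L"
        unfolding L_def using 4(3) kd(2) xV R_out[of "weight n x"] by (intro of_nat_mono ell_le_central) (auto simp: M_def)
      then have "1 / L \<le> inv_level n x"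
        unfolding inv_level_def using pos by (intro divide_left_mono mult_pos_pos) auto
      then show ?thesis using 4 scale by (simp add: mult.commute)
    qed
  qed
  have sub: "U \<subseteq> S" "D \<subseteq> S" by (auto simp: U_def D_def)
  have "(\<Sum>x\<in>S. v x) / L = (\<Sum>x\<in>S. v x / L)" by (rule sum_divide_distrib)
  also have "\<dots> \<le> (\<Sum>x\<in>S. ((if x \<in> U then inv_level n x * v x else 0)
      + (if x \<in> D then inv_level n x * v x else 0)) / 2
      + (if x \<in> M then 1 / L - inv_level n x else 0))"
    by (rule sum_mono) (rule pointwise)
  also have "\<dots> = ((\<Sum>x\<in>U. inv_level n x * v x) + (\<Sum>x\<in>D. inv_level n x * v x)) / 2
      + (\<Sum>x\<in>S \<inter> M. 1 / L - inv_level n x)"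
    using fin sub by (simp add: sum.distrib sum_divide_distrib[symmetric] sum.inter_restrict[symmetric] Int_absorb1)
  also have "\<dots> \<le> real k + (\<Sum>x\<in>M. 1 / L - inv_level n x)"
  proof -
    have "(\<Sum>x\<in>S \<inter> M. 1 / L - inv_level n x) \<le> (\<Sum>x\<in>M. 1 / L - inv_level n x)"
    proof (rule sum_mono2)
      fix x assume x: "x \<in> M - S \<inter> M"
      have "L \<le> real (ell (weight n x) n)"
        unfolding L_def using x kd(2) R_mem by (intro of_nat_mono ell_ge_central) (auto simp: M_def)
      then have "inv_level n x \<le> 1 / L"
        unfolding inv_level_def using L by (intro divide_left_mono mult_pos_pos) auto
      then show "0 \<le> 1 / L - inv_level n x" by simp
    qed (auto simp: M_def)
    moreover have "((\<Sum>x\<in>U. inv_level n x * v x) + (\<Sum>x\<in>D. inv_level n x * v x)) / 2 \<le> real k"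
      using zone_U zone_D by simp
    ultimately show ?thesis by (intro add_mono)
  qed
  also have "(\<Sum>x\<in>M. 1 / L - inv_level n x) = real (\<Sum>r\<in>R. ell r n) / L - real k"
  proof -
    have M: "M = (\<Union>r\<in>R. layer n r)" by (auto simp: M_def layer_def)
    have sumM: "(\<Sum>x\<in>M. f x) = (\<Sum>r\<in>R. \<Sum>x\<in>layer n r. f x)" for f :: "(nat \<Rightarrow> nat) \<Rightarrow> real"
      unfolding M by (rule sum.UNION_disjoint) (auto simp: layer_def R_def)
    have "(\<Sum>x\<in>M. inv_level n x) = (\<Sum>r\<in>R. 1)"
      unfolding sumM using kd by (intro sum.cong refl sum_inv_level) (auto simp: R_def)
    also have "\<dots> = real k"
    proof -
      have "Suc (k div 2 + (k - 1) div 2) = k" using k(1) by presburger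
      moreover have "(k - 1) div 2 \<le> n" using kd(1,2) by (rule order_trans)
      ultimately have "card R = k" unfolding R_def by (simp only: card_atLeastAtMost) linarith
      then show ?thesis by simp
    qed
    finally have "(\<Sum>x\<in>M. inv_level n x) = real k" .
    moreover have "(\<Sum>x\<in>M. 1 / L) = real (\<Sum>r\<in>R. ell r n) / L"
      unfolding sumM by (simp add: ell_eq sum_divide_distrib)
    ultimately show ?thesis by (simp only: sum_subtractf)
  qed
  finally have "(\<Sum>x\<in>S. v x) / L \<le> real (\<Sum>r\<in>R. ell r n) / L" by simp
  then have "(\<Sum>x\<in>S. v x) \<le> real (\<Sum>r\<in>R. ell r n)" using L by (simp add: divide_le_cancel)
  moreover have "(\<Sum>x\<in>S. v x) = real (card S) - B * real (\<Sum>x\<in>S. card (inner_neighbours n S x))"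
    unfolding v_def by (simp add: sum_subtractf sum_distrib_left)
  moreover have "B * real (\<Sum>x\<in>S. card (inner_neighbours n S x)) \<le> B * real (comp n S)"
    using B by (intro mult_left_mono of_nat_mono sum_inner_neighbours_le[OF S]) simp
  ultimately show ?thesis unfolding R_def by linarith
qed

text \<open>Deleting an element with at least \<rho> neighbours lowers the left side by \<rho> and
  the right side by at least \<rho>. This reduces the claim to sets in which all degrees are below
  \<rho>.\<close>

lemma supersaturation:
  assumes k: "1 \<le> k" "k \<le> n" and \<rho>: "0 < \<rho>"
    and B1: "fact k * (2 / real (n - k + 1)) ^ k \<le> 1 / \<rho>"
    and B2: "fact (Suc k) * (4 / real n) ^ Suc k \<le> 1 / \<rho>"
    and "S \<subseteq> ternary_cube n"
  shows "\<rho> * (real (card S) - real (\<Sum>r = n - (k - 1) div 2 .. n + k div 2. ell r n)) \<le> real (comp n S)"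
    (is "\<rho> * (_ - ?T) \<le> _")
  using assms(6)
proof (induction "card S" arbitrary: S rule: less_induct)
  case less
  have fin: "finite S" using less.prems by (rule finite_subset) simp
  show ?case
  proof (cases "\<exists>x\<in>S. \<rho> \<le> real (card (neighbours n S x))")
    case True
    then obtain x where x: "x \<in> S" "\<rho> \<le> real (card (neighbours n S x))" by blast
    have c: "card S = Suc (card (S - {x}))" using card.remove[OF fin x(1)] .
    then have "\<rho> * (real (card (S - {x})) - ?T) \<le> real (comp n (S - {x}))"
      using less.hyps[of "S - {x}"] less.prems by auto
    then have "\<rho> * (real (card S) - ?T) \<le> real (comp n (S - {x})) + \<rho>"
      unfolding c by (simp add: algebra_simps)
    also have "\<dots> \<le> real (comp n (S - {x}) + card (neighbours n S x))" using x(2) by simp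
    also have "\<dots> \<le> real (comp n S)" using comp_remove[OF fin x(1), of n] by (simp only: of_nat_le_iff)
    finally show ?thesis .
  next
    case False
    have "real (card S) \<le> ?T + 1 / \<rho> * real (comp n S)"
    proof (rule bounded_degree_inequality[OF less.prems k _ _ B1 B2])
      fix x assume x: "x \<in> S"
      have "card (inner_neighbours n S x) \<le> card (neighbours n S x)"
        using fin by (intro card_mono) (auto simp: inner_neighbours_def neighbours_def)
      then have "real (card (inner_neighbours n S x)) \<le> \<rho>" using False x by force
      then show "1 / \<rho> * real (card (inner_neighbours n S x)) \<le> 1" using \<rho> by simp
    qed (use \<rho> in simp)
    then have "\<rho> * (real (card S) - ?T) \<le> \<rho> * (1 / \<rho> * real (comp n S))"
      using \<rho> by (intro mult_left_mono) auto
    then show ?thesis using \<rho> by simp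
  qed
qed

section \<open>Comparison of the constants\<close>

lemma ell_ratio_le_prod:
  assumes "j + i \<le> 2 * n"
  shows "real (ell (j + i) n) / real (ell j n) \<le> (\<Prod>l<i. real (n + j + l) / real (Suc (j + l)))"
  using assms
proof (induction i)
  case 0
  then show ?case using ell_pos[of j n] by simp
next
  case (Suc i)
  have "real (Suc (j + i) * ell (Suc (j + i)) n) \<le> real ((n + (j + i)) * ell (j + i) n)"
    using ell_Suc_le[of "j + i" n] by (simp only: of_nat_le_iff)
  then have "real (ell (j + Suc i) n) \<le> real (ell (j + i) n) * (real (n + j + i) / real (Suc (j + i)))"
    by (simp add: pos_le_divide_eq field_simps)
  then have "real (ell (j + Suc i) n) / real (ell j n)
      \<le> real (ell (j + i) n) * (real (n + j + i) / real (Suc (j + i))) / real (ell j n)"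
    by (rule divide_right_mono) simp
  also have "\<dots> = real (ell (j + i) n) / real (ell j n) * (real (n + j + i) / real (Suc (j + i)))"
    by (rule times_divide_eq_left[symmetric])
  also have "\<dots> \<le> (\<Prod>l<i. real (n + j + l) / real (Suc (j + l))) * (real (n + j + i) / real (Suc (j + i)))"
    using Suc by (intro mult_right_mono) auto
  finally show ?case by simp
qed

lemma near_pair_numeric:
  assumes k: "1 \<le> k" and n: "9 * k\<^sup>2 \<le> n"
  shows "fact k * (2 / real (n - k + 1)) ^ k
    * ((\<Prod>l<k. real (n + (2 * k - 1) + l) / real (Suc (2 * k - 1 + l))) - 1) \<le> 1"
proof (cases "k = 1")
  case True
  then show ?thesis using n by (simp add: field_simps)
next
  case False
  then have k2: "2 \<le> k" using k by simp
  have kk: "k \<le> k\<^sup>2" using k by (simp add: power2_eq_square)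
  let ?P = "\<Prod>l<k. real (n + (2 * k - 1) + l) / real (Suc (2 * k - 1 + l))"
  have "fact k * (2 / real (n - k + 1)) ^ k = (\<Prod>l<k. 2 * real (Suc l) / real (n - k + 1))"
  proof -
    have "(\<Prod>l<k. 2 * real (Suc l) / real (n - k + 1)) = (\<Prod>l<k. real (Suc l) * (2 / real (n - k + 1)))"
      by (rule prod.cong) auto
    then show ?thesis unfolding prod.distrib by (simp add: fact_prod_Suc atLeast0LessThan)
  qed
  then have "fact k * (2 / real (n - k + 1)) ^ k * ?P
      = (\<Prod>l<k. 2 * real (Suc l) / real (n - k + 1) * (real (n + (2 * k - 1) + l) / real (Suc (2 * k - 1 + l))))"
    by (simp only: prod.distrib)
  also have "\<dots> \<le> 1"
  proof (rule prod_le_1)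
    fix l assume "l \<in> {..<k}"
    then have l: "l < k" by simp
    have lk: "real l + 1 \<le> real k" using l by linarith
    have n': "9 * (real k * real k) \<le> real n" using n by (metis of_nat_le_iff of_nat_mult of_nat_numeral power2_eq_square)
    have kk': "real k \<le> real k * real k" using k by simp
    have nn: "0 < real n - real k + 1" using n' kk' by linarith
    have a: "(2 * real l + 2) * (real n + 2 * real k - 1 + real l) \<le> (2 * real l + 2) * (real n + 3 * real k)"
      using lk by (intro mult_left_mono) auto
    have "(2 * real l + 2) * (4 * real k) \<le> (2 * real k) * (4 * real k)"
      using lk by (intro mult_right_mono) auto
    then have c: "(2 * real l + 2) * (4 * real k) \<le> 8 * (real k * real k)" by simp
    have "(2 * real l + 2) * (real n + 3 * real k)
        = (2 * real l + 2) * (real n - real k + 1) + (2 * real l + 2) * (4 * real k) - (2 * real l + 2)"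
      by (simp add: algebra_simps)
    \<comment> \<open>The error term is at most 8 k^2, and 9 k^2 <= n makes it at most n - k + 1.
      The extra summand fits because 2l + 3 <= 2k + l for l < k and k >= 2.\<close>
    also have "\<dots> \<le> (2 * real l + 2) * (real n - real k + 1) + (real n - real k + 1)"
      using c n' kk' by linarith
    also have "\<dots> = (2 * real l + 3) * (real n - real k + 1)" by (simp add: algebra_simps)
    also have "\<dots> \<le> (2 * real k + real l) * (real n - real k + 1)"
      using l k2 nn by (intro mult_right_mono) auto
    finally have main: "(2 * real l + 2) * (real n + 2 * real k - 1 + real l)
        \<le> (2 * real k + real l) * (real n - real k + 1)"
      using a by linarith
    have r: "real (n - k + 1) = real n - real k + 1" "real (n + (2 * k - 1) + l) = real n + 2 * real k - 1 + real l"
      "real (Suc (2 * k - 1 + l)) = 2 * real k + real l" "2 * real (Suc l) = 2 * real l + 2"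
      using n kk k by (auto simp: of_nat_diff)
    have pos: "0 < (real n - real k + 1) * (2 * real k + real l)"
      using nn k by (intro mult_pos_pos) auto
    show "0 \<le> 2 * real (Suc l) / real (n - k + 1) * (real (n + (2 * k - 1) + l) / real (Suc (2 * k - 1 + l)))
      \<and> 2 * real (Suc l) / real (n - k + 1) * (real (n + (2 * k - 1) + l) / real (Suc (2 * k - 1 + l))) \<le> 1"
    proof
      show "2 * real (Suc l) / real (n - k + 1) * (real (n + (2 * k - 1) + l) / real (Suc (2 * k - 1 + l))) \<le> 1"
        unfolding r times_divide_times_eq using main pos by (simp add: pos_divide_le_eq mult.commute)
    qed simp
  qed
  finally have "fact k * (2 / real (n - k + 1)) ^ k * ?P \<le> 1" .
  moreover have "0 \<le> fact k * (2 / real (n - k + 1)) ^ k" by simp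
  ultimately show ?thesis unfolding right_diff_distrib by linarith
qed

text \<open>The product is at most (2n)^k, against k + 1 factors 4 / n. One factor 1 / n is left
  over to absorb the constants.\<close>

lemma distant_pair_numeric:
  assumes k: "1 \<le> k" and n: "3 * k \<le> n" "fact (Suc k) * 4 ^ Suc k * 2 ^ k \<le> n"
  shows "fact (Suc k) * (4 / real n) ^ Suc k
    * ((\<Prod>l<k. real (n + (2 * k - 1) + l) / real (Suc (2 * k - 1 + l))) - 1) \<le> 1"
proof -
  let ?P = "\<Prod>l<k. real (n + (2 * k - 1) + l) / real (Suc (2 * k - 1 + l))"
  have npos: "0 < real n" using k n(1) by simp
  have "?P \<le> (\<Prod>l<k. 2 * real n)"
  proof (rule prod_mono, intro conjI)
    fix l assume "l \<in> {..<k}"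
    then have "real (n + (2 * k - 1) + l) \<le> 2 * real n * 1" using n(1) k by auto
    also have "\<dots> \<le> 2 * real n * real (Suc (2 * k - 1 + l))"
      by (intro mult_left_mono) auto
    finally show "real (n + (2 * k - 1) + l) / real (Suc (2 * k - 1 + l)) \<le> 2 * real n"
      by (simp only: pos_divide_le_eq of_nat_0_less_iff zero_less_Suc)
  qed simp
  then have P: "?P - 1 \<le> (2 * real n) ^ k" by simp
  have "fact (Suc k) * (4 / real n) ^ Suc k * (?P - 1) \<le> fact (Suc k) * (4 / real n) ^ Suc k * (2 * real n) ^ k"
    using P by (intro mult_left_mono) auto
  also have "\<dots> = fact (Suc k) * 4 ^ Suc k * 2 ^ k / real n"
    using npos by (simp add: power_divide power_mult_distrib field_simps)
  also have "\<dots> \<le> 1"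
  proof -
    have "real (fact (Suc k) * 4 ^ Suc k * 2 ^ k) \<le> real n" using n(2) by (simp only: of_nat_le_iff)
    then show ?thesis
      by (simp only: pos_divide_le_eq[OF npos] mult_1 of_nat_mult of_nat_fact of_nat_power of_nat_numeral)
  qed
  finally show ?thesis .
qed

theorem mainTheorem2:
  fixes k :: nat
  assumes "k \<ge> 1"
  shows "\<exists>n0::nat. \<forall>n\<ge>n0. \<forall>(t::int) S.
     S \<subseteq> ternary_cube n \<longrightarrow>
     int (card S) \<ge> int (\<Sum>r = n - (k - 1) div 2 .. n + k div 2. ell r n) + t \<longrightarrow>
     real (comp n S) \<ge> (real (ell (3*k - 1) n) / real (ell (2*k - 1) n) - 1) * real_of_int t"
proof (intro exI allI impI)
  fix n t S
  \<comment> \<open>The first summand of the threshold serves pairs exactly k layers apart, the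
    second one pairs farther apart.\<close>
  assume n: "9 * k\<^sup>2 + fact (Suc k) * 4 ^ Suc k * 2 ^ k \<le> n" and S: "S \<subseteq> ternary_cube n"
    and card: "int (card S) \<ge> int (\<Sum>r = n - (k - 1) div 2 .. n + k div 2. ell r n) + t"
  let ?T = "\<Sum>r = n - (k - 1) div 2 .. n + k div 2. ell r n"
  let ?P = "\<Prod>l<k. real (n + (2 * k - 1) + l) / real (Suc (2 * k - 1 + l))"
  define \<rho> where "\<rho> = real (ell (3*k - 1) n) / real (ell (2*k - 1) n) - 1"
  have "k \<le> k\<^sup>2" using assms by (simp add: power2_eq_square)
  then have nk: "9 * k \<le> n" "9 * k\<^sup>2 \<le> n" "fact (Suc k) * 4 ^ Suc k * 2 ^ k \<le> n" using n by linarith+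
  have idx: "3 * k - 1 = 2 * k - 1 + k" using assms by simp
  have pos: "0 < ell (2 * k - 1) n" using nk(1) by (intro ell_pos) auto
  have "ell (2 * k - 1) n \<le> ell (3 * k - 1) n" using nk(1) by (intro ell_mono) auto
  then have \<rho>: "0 \<le> \<rho>" using pos by (simp add: \<rho>_def)
  have \<rho>_le: "\<rho> \<le> ?P - 1"
    unfolding \<rho>_def idx using ell_ratio_le_prod[of "2 * k - 1" k n] nk(1) by simp
  \<comment> \<open>Only \<rho> >= 0 matters here, so negative \<open>t\<close> is covered as
    well.\<close>
  have "\<rho> * real_of_int t \<le> \<rho> * (real (card S) - real ?T)"
    using \<rho> card by (intro mult_left_mono) linarith+
  also have "\<dots> \<le> real (comp n S)"
  proof (cases "\<rho> = 0")
    case False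
    then have \<rho>_pos: "0 < \<rho>" using \<rho> by simp
    have transfer: "a \<le> 1 / \<rho>" if "a * (?P - 1) \<le> 1" "0 \<le> a" for a
    proof -
      have "a * \<rho> \<le> a * (?P - 1)" using \<rho>_le that(2) by (rule mult_left_mono)
      then show ?thesis using that(1) \<rho>_pos by (simp add: pos_le_divide_eq)
    qed
    show ?thesis
    proof (rule supersaturation[OF assms _ \<rho>_pos _ _ S])
      show "fact k * (2 / real (n - k + 1)) ^ k \<le> 1 / \<rho>"
        using near_pair_numeric[OF assms nk(2)] by (rule transfer) simp
      show "fact (Suc k) * (4 / real n) ^ Suc k \<le> 1 / \<rho>"
        using distant_pair_numeric[OF assms _ nk(3)] nk(1) by (intro transfer) auto
    qed (use nk(1) in simp)
  qed simp
  finally show "(real (ell (3*k - 1) n) / real (ell (2*k - 1) n) - 1) * real_of_int t \<le> real (comp n S)"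
    unfolding \<rho>_def .
qed

end
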